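(* Let $0<s<3$. Let $\omega:S^2\to\mathbb{R}$ be smooth with $\min\omega\ge0$, $\omega(\bar{\mathbf{x}})=\omega(-\bar{\mathbf{x}})$, and axisymmetric with respect to the $x_3$-axis, and suppose $\tilde\omega\ge c>0$ on $S^2$ for some constant $c$, where $\tilde\omega$ is the angle function of the Fourier transform of $|\mathbf{x}|^{-s}\omega(\bar{\mathbf{x}})$. For $\alpha>0$ let $(a_\alpha,b_\alpha)\in(0,\infty)^2$ be the unique pair such that $\rho_{a_\alpha,b_\alpha}$ is the unique (up to translation) energy minimizer for $W_\alpha(\mathbf{x})=|\mathbf{x}|^{-s}(1+\alpha\omega(\bar{\mathbf{x}}))+|\mathbf{x}|^2$. Then $a_\alpha$ and $b_\alpha$ scale like $\alpha^{1/(2+s)}$ as $\alpha\to\infty$; that is, the limits $$\lim_{\alpha\to\infty}a_\alpha\,\alpha^{-1/(2+s)}\quad\text{and}\quad\lim_{\alpha\to\infty}b_\alpha\,\alpha^{-1/(2+s)}$$ exist and are positive (finite) numbers.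
   Context: For $\mathbf{x}\in\mathbb{R}^3\setminus\{0\}$, $\bar{\mathbf{x}}=\mathbf{x}/|\mathbf{x}|\in S^2$. The energy of a probability measure $\rho$ on $\mathbb{R}^3$ for a potential $W$ is $E[\rho]=\frac12\int\int W(\mathbf{x}-\mathbf{y})\,\rho(\mathbf{y})\,d\mathbf{y}\,\rho(\mathbf{x})\,d\mathbf{x}$; an energy minimizer is a minimizer over all probability measures on $\mathbb{R}^3$. Fourier transform: $\mathcal{F}[f](\xi)=\int_{\mathbb{R}^3}f(\mathbf{x})e^{-2\pi i\mathbf{x}\cdot\xi}\,d\mathbf{x}$, extended to tempered distributions. For smooth even $\omega$ on $S^2$ and $0<s<3$, $\mathcal{F}[|\mathbf{x}|^{-s}\omega(\bar{\mathbf{x}})]=|\xi|^{-3+s}\tilde\omega(\bar\xi)$ with $\bar\xi=\xi/|\xi|$ and $\tilde\omega$ smooth on $S^2$; this defines $\tilde\omega$. Let $\rho_3(\mathbf{x})=C_3(R_3^2-|\mathbf{x}|^2)_+^{(s-1)/2}$ on $\mathbb{R}^3$, with $C_3=\frac{3\cos\frac{s\pi}{2}}{s(1-s)\pi}$ and $R_3=\Big(\frac{6\cos\frac{s\pi}{2}}{s(1-s)\pi}\beta\big(\tfrac32,\tfrac{1+s}{2}\big)\Big)^{-1/(s+2)}$ ($\beta$ the Beta function; removable singularity at $s=1$ filled in by continuity), a probability density. For $a,b>0$ let $\rho_{a,b}(\mathbf{x})=\frac{1}{a^2b}\rho_3\big(\frac{x_1}{a},\frac{x_2}{a},\frac{x_3}{b}\big)$.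 Existence and uniqueness of $(a_\alpha,b_\alpha)$ is a known theorem: if $\Omega$ is smooth, strictly positive, even and axisymmetric about the $x_3$-axis with $\tilde\Omega\ge c>0$, then there is a unique pair $(a,b)\in(0,\infty)^2$ such that $\rho_{a,b}$ is the unique energy minimizer (up to translation) for $|\mathbf{x}|^{-s}\Omega(\bar{\mathbf{x}})+|\mathbf{x}|^2$. It is applied to $\Omega_\alpha=1+\alpha\omega$, for which $\tilde\Omega_\alpha=c_s+\alpha\tilde\omega$ with $c_s=\pi^{s-3/2}\frac{\Gamma((3-s)/2)}{\Gamma(s/2)}>0$.
   Formalization: The printed constant C_3 lacks a factor π in the denominator (with the given R_3, the density ρ_3 would have total mass π, not 1); here C_3 = 3cos(sπ/2)/(s(1−s)π²), which makes ρ_3 a probability density. *)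

theory Defs
  imports "HOL-Analysis.Analysis" "HOL-Probability.Probability"
begin

section \<open>Smooth functions\<close>

text \<open>Iterated directional derivatives; for directions in \<^const>\<open>Basis\<close> these are the iterated
  partial derivatives.\<close>

primrec iter_deriv :: "'a list \<Rightarrow> ('a::euclidean_space \<Rightarrow> 'b::real_normed_vector) \<Rightarrow> 'a \<Rightarrow> 'b" where
  "iter_deriv [] f = f"
| "iter_deriv (v # vs) f = (\<lambda>x. frechet_derivative (iter_deriv vs f) (at x) v)"

text \<open>All iterated partial derivatives exist and are (totally) differentiable; for open
  \<open>U\<close> this is \<open>C\<^sup>\<infinity>\<close>. Only meant for open \<open>U\<close>.\<close>

definition smooth_on_open :: "'a set \<Rightarrow> ('a::euclidean_space \<Rightarrow> 'b::real_normed_vector) \<Rightarrow> bool" where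
  "smooth_on_open U f \<longleftrightarrow>
     (\<forall>vs. set vs \<subseteq> Basis \<longrightarrow> (\<forall>x\<in>U. iter_deriv vs f differentiable (at x)))"

text \<open>Smoothness on the unit sphere (as a submanifold): the function is the restriction of a smooth
  function on a neighbourhood. Values of \<open>f\<close> off the sphere are irrelevant.\<close>

definition smooth_on_sphere :: "('a::euclidean_space \<Rightarrow> 'b::real_normed_vector) \<Rightarrow> bool" where
  "smooth_on_sphere f \<longleftrightarrow>
     (\<exists>U F. open U \<and> sphere 0 1 \<subseteq> U \<and> smooth_on_open U F \<and> (\<forall>x\<in>sphere 0 1. F x = f x))"

definition schwartz :: "('a::euclidean_space \<Rightarrow> complex) \<Rightarrow> bool" where
  "schwartz \<phi> \<longleftrightarrow> smooth_on_open UNIV \<phi> \<and>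
     (\<forall>vs (k::nat). set vs \<subseteq> Basis \<longrightarrow> (\<exists>C. \<forall>x. norm x ^ k * norm (iter_deriv vs \<phi> x) \<le> C))"

section \<open>Fourier transform and angle functions\<close>

definition fourier :: "('a::euclidean_space \<Rightarrow> complex) \<Rightarrow> 'a \<Rightarrow> complex" where
  "fourier f \<xi> = (LINT x|lborel. f x * cis (- 2 * pi * (x \<bullet> \<xi>)))"

text \<open>\<open>g\<close> is the Fourier transform of \<open>f\<close> in the sense of tempered distributions, for distributions
  given by functions: \<open>\<langle>F[f], \<phi>\<rangle> = \<langle>f, F[\<phi>]\<rangle>\<close> for all Schwartz functions \<open>\<phi>\<close>. The integrability
  conditions say that both pairings make sense (Bochner integrals default to 0).\<close>

definition has_tempered_fourier ::
  "('a::euclidean_space \<Rightarrow> complex) \<Rightarrow> ('a \<Rightarrow> complex) \<Rightarrow> bool" where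
  "has_tempered_fourier f g \<longleftrightarrow>
     (\<forall>\<phi>. schwartz \<phi> \<longrightarrow>
        integrable lborel (\<lambda>x. f x * fourier \<phi> x) \<and>
        integrable lborel (\<lambda>\<xi>. g \<xi> * \<phi> \<xi>) \<and>
        (LINT x|lborel. f x * fourier \<phi> x) = (LINT \<xi>|lborel. g \<xi> * \<phi> \<xi>))"

text \<open>\<open>\<omega>t\<close> is the (unique, on the sphere) smooth angle function with
  \<open>F[|x|\<^sup>-\<^sup>s \<omega>(x/|x|)] = |\<xi>|\<^sup>s\<^sup>-\<^sup>3 \<omega>t(\<xi>/|\<xi>|)\<close>. Note that \<open>x/|x|\<close> is \<^term>\<open>sgn x\<close>; the
  value at the origin is immaterial here.\<close>

definition is_fourier_angle :: "real \<Rightarrow> (real^3 \<Rightarrow> real) \<Rightarrow> (real^3 \<Rightarrow> real) \<Rightarrow> bool" where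
  "is_fourier_angle s \<omega> \<omega>t \<longleftrightarrow> smooth_on_sphere \<omega>t \<and>
     has_tempered_fourier
       (\<lambda>x. complex_of_real (norm x powr (- s) * \<omega> (sgn x)))
       (\<lambda>\<xi>. complex_of_real (norm \<xi> powr (s - 3) * \<omega>t (sgn \<xi>)))"

section \<open>Axial symmetry\<close>

definition rot3 :: "real \<Rightarrow> real^3 \<Rightarrow> real^3" where
  "rot3 \<theta> x = vector [cos \<theta> * x$1 - sin \<theta> * x$2, sin \<theta> * x$1 + cos \<theta> * x$2, x$3]"

definition axisymmetric3 :: "(real^3 \<Rightarrow> real) \<Rightarrow> bool" where
  "axisymmetric3 \<omega> \<longleftrightarrow> (\<forall>\<theta>. \<forall>x\<in>sphere 0 1. \<omega> (rot3 \<theta> x) = \<omega> x)"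

section \<open>Energies and minimizers\<close>

text \<open>The interaction potential \<open>|x|\<^sup>-\<^sup>s \<Omega>(x/|x|) + |x|\<^sup>2\<close>, for \<open>\<Omega> > 0\<close> on the sphere.
  It is singular at the origin and must be \<open>\<infinity>\<close> there (so that atoms have infinite energy),
  whereas \<^term>\<open>0 powr (- s) = (0::real)\<close>.\<close>

definition potential :: "real \<Rightarrow> (real^3 \<Rightarrow> real) \<Rightarrow> real^3 \<Rightarrow> ennreal" where
  "potential s \<Omega> x =
     (if x = 0 then \<infinity> else ennreal (norm x powr (- s) * \<Omega> (sgn x) + (norm x)\<^sup>2))"

definition energy :: "('a::euclidean_space \<Rightarrow> ennreal) \<Rightarrow> 'a measure \<Rightarrow> ennreal" where
  "energy W \<mu> = (\<integral>\<^sup>+x. (\<integral>\<^sup>+y. W (x - y) \<partial>\<mu>) \<partial>\<mu>) / 2"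

definition borel_prob :: "'a::euclidean_space measure \<Rightarrow> bool" where
  "borel_prob \<mu> \<longleftrightarrow> prob_space \<mu> \<and> sets \<mu> = sets borel"

definition energy_minimizer :: "('a::euclidean_space \<Rightarrow> ennreal) \<Rightarrow> 'a measure \<Rightarrow> bool" where
  "energy_minimizer W \<mu> \<longleftrightarrow> borel_prob \<mu> \<and> (\<forall>\<nu>. borel_prob \<nu> \<longrightarrow> energy W \<mu> \<le> energy W \<nu>)"

definition unique_energy_minimizer :: "('a::euclidean_space \<Rightarrow> ennreal) \<Rightarrow> 'a measure \<Rightarrow> bool" where
  "unique_energy_minimizer W \<mu> \<longleftrightarrow> energy_minimizer W \<mu> \<and>
     (\<forall>\<nu>. energy_minimizer W \<nu> \<longrightarrow> (\<exists>t. \<nu> = distr \<mu> borel (\<lambda>x. x + t)))"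

section \<open>The ellipsoidal densities\<close>

text \<open>\<open>cos (s\<pi>/2) / ((1 - s)\<pi>)\<close>, continuously extended to \<open>s = 1\<close>.\<close>

definition cos_quot :: "real \<Rightarrow> real" where
  "cos_quot s = (if s = 1 then 1 / 2 else cos (s * pi / 2) / ((1 - s) * pi))"

text \<open>The constant \<open>C\<^sub>3\<close> is \<open>3 cos (s\<pi>/2) / (s (1 - s) \<pi>\<^sup>2)\<close>. With the given radius \<open>R\<^sub>3\<close>, this is
  the value for which \<open>\<rho>\<^sub>3\<close> has total mass \<open>2 \<pi> C\<^sub>3 R\<^sub>3\<^sup>s\<^sup>+\<^sup>2 \<beta>(3/2, (1+s)/2) = 1\<close> (for \<open>s = 1\<close>: the
  uniform density \<open>3/(2\<pi>)\<close>, as forced by \<open>\<Delta>(1/|x| + |x|\<^sup>2) = -4\<pi>\<delta> + 6\<close>). The value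
  \<open>3 cos (s\<pi>/2) / (s (1 - s) \<pi>)\<close>, with a single \<open>\<pi>\<close>, is a misprint: it gives total mass \<open>\<pi>\<close>.\<close>

definition C3 :: "real \<Rightarrow> real" where
  "C3 s = 3 * cos_quot s / (s * pi)"

definition R3 :: "real \<Rightarrow> real" where
  "R3 s = (6 * cos_quot s / s * Beta (3 / 2) ((1 + s) / 2)) powr (- 1 / (s + 2))"

text \<open>The case distinction is the positive part \<open>(R\<^sub>3\<^sup>2 - |x|\<^sup>2)\<^sub>+\<close>: the density vanishes outside the
  ball, also when the exponent is negative or zero.\<close>

definition rho3 :: "real \<Rightarrow> real^3 \<Rightarrow> real" where
  "rho3 s x = (if norm x < R3 s then C3 s * ((R3 s)\<^sup>2 - (norm x)\<^sup>2) powr ((s - 1) / 2) else 0)"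

definition rho_ab :: "real \<Rightarrow> real \<Rightarrow> real \<Rightarrow> real^3 \<Rightarrow> real" where
  "rho_ab s a b x = 1 / (a\<^sup>2 * b) * rho3 s (vector [x$1 / a, x$2 / a, x$3 / b])"

definition rho_measure :: "real \<Rightarrow> real \<Rightarrow> real \<Rightarrow> (real^3) measure" where
  "rho_measure s a b = density lborel (\<lambda>x. ennreal (rho_ab s a b x))"

end

theory Submission
  imports Defs "HOL-Real_Asymp.Real_Asymp"
begin

text \<open>
  Measure lengths in units of \<open>l = \<alpha>\<^sup>1\<^sup>/\<^sup>(\<^sup>2\<^sup>+\<^sup>s\<^sup>)\<close>, that is, put \<open>a = lA\<close> and \<open>b = lB\<close>. Because
  \<open>\<alpha> l\<^sup>-\<^sup>s = l\<^sup>2\<close>, the energy of the spheroidal density becomes \<open>l\<^sup>2\<close> times the energy for the potential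
  \<open>|x|\<^sup>-\<^sup>s (1/\<alpha> + \<omega>) + |x|\<^sup>2\<close>. As \<open>\<alpha> \<rightarrow> \<infinity>\<close> the isotropic repulsion disappears, and the claim says that
  \<open>(A, B)\<close> converges to the best spheroid for \<open>|x|\<^sup>-\<^sup>s \<omega> + |x|\<^sup>2\<close>, which has positive half-axes. The
  competitors are spheroidal densities; uniqueness among all measures serves to see that the energy
  is finite (\<open>unique_minimizer_finite_energy\<close>).

  Why the limit problem is well-posed: the difference of two points of the reference density has a
  radial distribution, and the potential is homogeneous, so up to a constant factor the anisotropic
  energy is \<open>\<integral> |Dx|\<^sup>-\<^sup>s \<omega>(Dx/|Dx|) exp(-\<pi>|x|\<^sup>2) dx\<close> with \<open>D = diag(A, A, B)\<close>
  (\<open>homogeneous_radial_ratio\<close>, \<open>energy_potential_rho_measure\<close>). Gaussians are Schwartz functions with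
  Gaussian transforms, so the definition of the Fourier transform turns this into
  \<open>\<integral> |\<xi>|\<^sup>s\<^sup>-\<^sup>3 \<omega>t(\<xi>/|\<xi>|) exp(-\<pi>(p \<xi>\<^sub>1\<^sup>2 + p \<xi>\<^sub>2\<^sup>2 + q \<xi>\<^sub>3\<^sup>2)) d\<xi>\<close> with \<open>p = A\<^sup>2\<close>, \<open>q = B\<^sup>2\<close>
  (\<open>tempered_fourier_gaussian_integral\<close>). Since \<open>\<omega>t > 0\<close>, this is strictly convex in \<open>(p, q)\<close>, and the
  confinement is linear in \<open>(p, q)\<close>. So the energy is strictly convex, lower semicontinuous and coercive on
  the closed quadrant; its unique minimizer is not on the boundary because \<open>\<omega>t \<ge> c\<close> makes the slope
  there infinite, and minimizing sequences converge to it (\<open>tilted_moment_well_posed\<close>).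

  Finally \<open>(A\<^sup>2, B\<^sup>2)\<close> is minimizing: comparison with the limiting optimum shows that its limit
  energy exceeds the minimum by at most \<open>1/\<alpha>\<close> times a finite isotropic energy.
\<close>

section \<open>Gaussians as test functions\<close>

definition gauss :: "('a \<Rightarrow> real) \<Rightarrow> 'a::euclidean_space \<Rightarrow> real" where
  "gauss d x = exp (- pi * (\<Sum>b\<in>Basis. d b * (x \<bullet> b)\<^sup>2))"

lemma gauss_nonneg [simp]: "0 \<le> gauss d x"
  by (simp add: gauss_def)

text \<open>Polynomial times Gaussian is a class closed under directional derivatives, and each member is
  dominated by every inverse power of the norm; this is how Gaussians are seen to be Schwartz
  functions. The next two lemmas are the polynomial half: closure under derivatives and polynomial
  growth, each by induction over the construction of the polynomial.\<close>

lemma polynomial_deriv: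
  fixes p :: "'a::euclidean_space \<Rightarrow> real"
  assumes "real_polynomial_function p"
  shows "\<exists>p'. real_polynomial_function p' \<and> (\<forall>x. frechet_derivative p (at x) v = p' x)"
  using assms
proof (induction p rule: real_polynomial_function.induct)
  case (linear f)
  then have "frechet_derivative f (at x) = f" for x
    using bounded_linear_imp_has_derivative frechet_derivative_at by metis
  then show ?case by (auto intro!: exI[of _ "\<lambda>_. f v"] real_polynomial_function.intros(2))
next
  case (const c)
  show ?case by (auto intro!: exI[of _ "\<lambda>_. 0"] real_polynomial_function.intros(2))
next
  case (add f g)
  then obtain f' g' where fg: "real_polynomial_function f'" "real_polynomial_function g'"
    "\<And>x. frechet_derivative f (at x) v = f' x" "\<And>x. frechet_derivative g (at x) v = g' x" by auto
  have "frechet_derivative (\<lambda>x. f x + g x) (at x) v = f' x + g' x" for x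
  proof -
    have "((\<lambda>x. f x + g x) has_derivative
        (\<lambda>h. frechet_derivative f (at x) h + frechet_derivative g (at x) h)) (at x)"
      using add.hyps by (intro has_derivative_add)
        (simp_all add: differentiable_at_real_polynomial_function frechet_derivative_works[THEN iffD1])
    from frechet_derivative_at[OF this, symmetric] show ?thesis
      by (simp add: fg(3,4))
  qed
  with fg show ?case by (auto intro!: exI[of _ "\<lambda>x. f' x + g' x"])
next
  case (mult f g)
  then obtain f' g' where fg: "real_polynomial_function f'" "real_polynomial_function g'"
    "\<And>x. frechet_derivative f (at x) v = f' x" "\<And>x. frechet_derivative g (at x) v = g' x" by auto
  have "frechet_derivative (\<lambda>x. f x * g x) (at x) v = f x * g' x + f' x * g x" for x
  proof -
    have "((\<lambda>x. f x * g x) has_derivative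
        (\<lambda>h. f x * frechet_derivative g (at x) h + frechet_derivative f (at x) h * g x)) (at x)"
      using mult.hyps by (intro has_derivative_mult)
        (simp_all add: differentiable_at_real_polynomial_function frechet_derivative_works[THEN iffD1])
    from frechet_derivative_at[OF this, symmetric] show ?thesis
      by (simp add: fg(3,4))
  qed
  with fg mult.hyps show ?case by (auto intro!: exI[of _ "\<lambda>x. f x * g' x + f' x * g x"])
qed

lemma polynomial_growth:
  fixes p :: "'a::euclidean_space \<Rightarrow> real"
  assumes "real_polynomial_function p"
  shows "\<exists>C N. 0 \<le> C \<and> (\<forall>x. \<bar>p x\<bar> \<le> C * (1 + norm x) ^ N)"
  using assms
proof (induction p rule: real_polynomial_function.induct)
  case (linear f)
  then obtain K where K: "0 \<le> K" "\<And>x. norm (f x) \<le> norm x * K"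
    using bounded_linear.nonneg_bounded by blast
  then have "\<bar>f x\<bar> \<le> K * (1 + norm x) ^ 1" for x
    by (smt (verit) mult.commute power_one_right real_norm_def mult_left_mono)
  then show ?case using K(1) by blast
next
  case (const c)
  show ?case by (intro exI[of _ "\<bar>c\<bar>"] exI[of _ 0]) auto
next
  case (add f g)
  then obtain C N D M where A: "0 \<le> C" "0 \<le> D" "\<And>x. \<bar>f x\<bar> \<le> C * (1 + norm x) ^ N"
    "\<And>x. \<bar>g x\<bar> \<le> D * (1 + norm x) ^ M" by auto
  have "\<bar>f x + g x\<bar> \<le> (C + D) * (1 + norm x) ^ (N + M)" for x
  proof -
    have "C * (1 + norm x) ^ N \<le> C * (1 + norm x) ^ (N + M)"
      "D * (1 + norm x) ^ M \<le> D * (1 + norm x) ^ (N + M)"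
      using A by (auto intro!: mult_left_mono power_increasing)
    then show ?thesis using A(3,4)[of x] by (simp add: ring_distribs)
  qed
  then show ?case using A by (intro exI[of _ "C + D"] exI[of _ "N + M"]) auto
next
  case (mult f g)
  then obtain C N D M where A: "0 \<le> C" "0 \<le> D" "\<And>x. \<bar>f x\<bar> \<le> C * (1 + norm x) ^ N"
    "\<And>x. \<bar>g x\<bar> \<le> D * (1 + norm x) ^ M" by auto
  have "\<bar>f x * g x\<bar> \<le> (C * D) * (1 + norm x) ^ (N + M)" for x
    using mult_mono[OF A(3)[of x] A(4)[of x]] A
    by (simp add: abs_mult power_add mult_ac)
  then show ?case using A by (intro exI[of _ "C * D"] exI[of _ "N + M"]) auto
qed

lemma polynomial_quadratic_form:
  "real_polynomial_function (\<lambda>x::'a::euclidean_space. \<Sum>b\<in>Basis. d b * (x \<bullet> b)\<^sup>2)"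
  unfolding power2_eq_square
  by (intro real_polynomial_function_sum real_polynomial_function.intros(4) real_polynomial_function.intros(2)
      real_polynomial_function.intros(1) bounded_linear_inner_left) auto

lemma gauss_deriv:
  fixes d :: "'a::euclidean_space \<Rightarrow> real"
  shows "(gauss d has_derivative (\<lambda>h. gauss d x * (- pi *
     frechet_derivative (\<lambda>x. \<Sum>b\<in>Basis. d b * (x \<bullet> b)\<^sup>2) (at x) h))) (at x)"
proof -
  have "((\<lambda>x. \<Sum>b\<in>Basis. d b * (x \<bullet> b)\<^sup>2) has_derivative
      frechet_derivative (\<lambda>x. \<Sum>b\<in>Basis. d b * (x \<bullet> b)\<^sup>2) (at x)) (at x)"
    by (rule frechet_derivative_works[THEN iffD1] differentiable_at_real_polynomial_function
        polynomial_quadratic_form)+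
  from has_derivative_exp[OF has_derivative_mult_right[OF this, of "-pi"]]
  show ?thesis unfolding gauss_def by (simp only: mult_ac)
qed

lemma iter_deriv_poly_gauss:
  fixes d :: "'a::euclidean_space \<Rightarrow> real"
  shows "\<exists>p. real_polynomial_function p \<and>
           iter_deriv vs (\<lambda>x. complex_of_real (gauss d x)) = (\<lambda>x. complex_of_real (p x * gauss d x))"
proof (induction vs)
  case Nil
  show ?case by (auto intro!: exI[of _ "\<lambda>_. 1"] real_polynomial_function.intros(2))
next
  case (Cons v vs)
  then obtain p where p: "real_polynomial_function p"
    "iter_deriv vs (\<lambda>x. complex_of_real (gauss d x)) = (\<lambda>x. complex_of_real (p x * gauss d x))" by auto
  define q where "q = (\<lambda>x::'a. \<Sum>b\<in>Basis. d b * (x \<bullet> b)\<^sup>2)"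
  have q: "real_polynomial_function q" unfolding q_def by (rule polynomial_quadratic_form)
  obtain p' where p': "real_polynomial_function p'" "\<And>x. frechet_derivative p (at x) v = p' x"
    using polynomial_deriv[OF p(1)] by blast
  obtain q' where q': "real_polynomial_function q'" "\<And>x. frechet_derivative q (at x) v = q' x"
    using polynomial_deriv[OF q] by blast
  have "frechet_derivative (\<lambda>x. complex_of_real (p x * gauss d x)) (at x) v =
      complex_of_real ((p' x + p x * (- pi * q' x)) * gauss d x)" for x
  proof -
    have "(p has_derivative frechet_derivative p (at x)) (at x)"
      by (intro frechet_derivative_works[THEN iffD1] differentiable_at_real_polynomial_function p)
    from has_derivative_of_real[OF has_derivative_mult[OF this gauss_deriv], where 'a = complex]
    have "frechet_derivative (\<lambda>x. complex_of_real (p x * gauss d x)) (at x) = (\<lambda>h. complex_of_real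
       (p x * (gauss d x * (- pi * frechet_derivative q (at x) h)) + frechet_derivative p (at x) h * gauss d x))"
      unfolding q_def by (rule frechet_derivative_at[symmetric])
    then show ?thesis by (simp add: p' q' algebra_simps)
  qed
  then show ?case
    using p q p' q' by (intro exI[of _ "\<lambda>x. p' x + p x * (- pi * q' x)"])
      (auto intro!: real_polynomial_function.intros(4) real_polynomial_function.intros(2) real_polynomial_function.intros(3)
         real_polynomial_function_minus)
qed

text \<open>A power is bounded by its factorial times an exponential, and completing the square bounds
  \<open>r - \<delta>r\<^sup>2\<close> by \<open>1/(4\<delta>)\<close>.\<close>

lemma power_exp_quadratic_bounded:
  assumes "0 < (\<delta>::real)" "0 \<le> r"
  shows "(1 + r) ^ N * exp (- \<delta> * r\<^sup>2) \<le> fact N * exp (1 + 1 / (4 * \<delta>))"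
proof -
  have "(1 + r) ^ N / fact N \<le> exp (1 + r)"
  proof -
    have "(\<Sum>n\<in>{N}. (1 + r) ^ n /\<^sub>R fact n) \<le> (\<Sum>n. (1 + r) ^ n /\<^sub>R fact n)"
      using assms by (intro sum_le_suminf summable_exp_generic) auto
    then show ?thesis by (simp add: exp_def divide_inverse mult.commute)
  qed
  then have "(1 + r) ^ N \<le> fact N * exp (1 + r)" by (simp add: field_simps)
  then have "(1 + r) ^ N * exp (- \<delta> * r\<^sup>2) \<le> fact N * exp (1 + r) * exp (- \<delta> * r\<^sup>2)"
    by (intro mult_right_mono) auto
  also have "\<dots> = fact N * exp (1 + r - \<delta> * r\<^sup>2)" by (simp add: mult_exp_exp)
  also have "\<dots> \<le> fact N * exp (1 + 1 / (4 * \<delta>))"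
  proof -
    have "0 \<le> (2 * \<delta> * r - 1)\<^sup>2 / (4 * \<delta>)" using assms by auto
    also have "\<dots> = \<delta> * r\<^sup>2 - r + 1 / (4 * \<delta>)"
      using assms by (simp add: field_simps power2_eq_square)
    finally show ?thesis by auto
  qed
  finally show ?thesis .
qed

lemma schwartz_gauss:
  fixes d :: "'a::euclidean_space \<Rightarrow> real"
  assumes d: "\<And>b. b \<in> Basis \<Longrightarrow> 0 < d b"
  shows "schwartz (\<lambda>x. complex_of_real (gauss d x))"
  unfolding schwartz_def smooth_on_open_def
proof (intro conjI allI impI ballI)
  fix vs :: "'a list" and x :: 'a
  obtain p where p: "real_polynomial_function p"
    "iter_deriv vs (\<lambda>x. complex_of_real (gauss d x)) = (\<lambda>x. complex_of_real (p x * gauss d x))"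
    using iter_deriv_poly_gauss[of vs d] by auto
  have "(p has_derivative frechet_derivative p (at x)) (at x)"
    by (intro frechet_derivative_works[THEN iffD1] differentiable_at_real_polynomial_function p)
  from has_derivative_of_real[OF has_derivative_mult[OF this gauss_deriv], where 'a = complex]
  show "iter_deriv vs (\<lambda>x. complex_of_real (gauss d x)) differentiable at x"
    unfolding p differentiable_def by blast
next
  fix vs :: "'a list" and k :: nat
  obtain p where p: "real_polynomial_function p"
    "iter_deriv vs (\<lambda>x. complex_of_real (gauss d x)) = (\<lambda>x. complex_of_real (p x * gauss d x))"
    using iter_deriv_poly_gauss[of vs d] by auto
  obtain C N where C: "0 \<le> C" "\<And>x. \<bar>p x\<bar> \<le> C * (1 + norm x) ^ N"
    using polynomial_growth[OF p(1)] by blast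
  define \<delta> where "\<delta> = pi * Min (d ` Basis)"
  have \<delta>: "0 < \<delta>" using d by (auto simp: \<delta>_def)
  have g: "gauss d x \<le> exp (- \<delta> * (norm x)\<^sup>2)" for x
  proof -
    have "\<delta> * (norm x)\<^sup>2 = pi * (\<Sum>b\<in>Basis. Min (d ` Basis) * (x \<bullet> b)\<^sup>2)"
      unfolding \<delta>_def norm_conv_dist
      by (simp add: norm_eq_sqrt_inner euclidean_inner[of x x] sum_distrib_left power2_eq_square sum_nonneg mult.assoc)
    also have "\<dots> \<le> pi * (\<Sum>b\<in>Basis. d b * (x \<bullet> b)\<^sup>2)"
      by (intro mult_left_mono sum_mono mult_right_mono) auto
    finally show ?thesis by (simp add: gauss_def)
  qed
  have "norm x ^ k * norm (iter_deriv vs (\<lambda>x. complex_of_real (gauss d x)) x)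
      \<le> C * (fact (k + N) * exp (1 + 1 / (4 * \<delta>)))" for x
  proof -
    have "norm x ^ k * norm (iter_deriv vs (\<lambda>x. complex_of_real (gauss d x)) x)
       = norm x ^ k * (\<bar>p x\<bar> * gauss d x)" unfolding p norm_of_real by (simp add: abs_mult)
    also have "\<dots> \<le> (1 + norm x) ^ k * (C * (1 + norm x) ^ N * exp (- \<delta> * (norm x)\<^sup>2))"
      by (intro mult_mono C g power_mono mult_nonneg_nonneg) (auto simp: C)
    also have "\<dots> = C * ((1 + norm x) ^ (k + N) * exp (- \<delta> * (norm x)\<^sup>2))"
      by (simp add: power_add mult_ac)
    also have "\<dots> \<le> C * (fact (k + N) * exp (1 + 1 / (4 * \<delta>)))"
      by (intro mult_left_mono power_exp_quadratic_bounded \<delta> C) auto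
    finally show ?thesis .
  qed
  then show "\<exists>C. \<forall>x. norm x ^ k * norm (iter_deriv vs (\<lambda>x. complex_of_real (gauss d x)) x) \<le> C"
    by blast
qed

text \<open>The characteristic function of the standard normal distribution, rescaled by
  \<open>c = \<surd>(2\<pi>t)\<close> so that \<open>(cx)\<^sup>2/2 = \<pi>tx\<^sup>2\<close>.\<close>

lemma fourier_gauss_1:
  fixes t k :: real
  assumes t: "0 < t"
  shows "integrable lborel (\<lambda>x. complex_of_real (exp (- pi * (t * x\<^sup>2))) * cis (- 2 * pi * (x * k)))"
    and "(LINT x|lborel. complex_of_real (exp (- pi * (t * x\<^sup>2))) * cis (- 2 * pi * (x * k))) =
      complex_of_real (exp (- pi * (k\<^sup>2 / t)) / sqrt t)"
proof -
  define c where "c = sqrt (2 * pi * t)"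
  define u where "u = - 2 * pi * k / c"
  have c: "0 < c" using t by (simp add: c_def)
  have c2: "c\<^sup>2 = 2 * pi * t" using t by (simp add: c_def)
  define F where "F = (\<lambda>x. std_normal_density x *\<^sub>R iexp (u * x))"
  have intF: "integrable lborel F"
  proof -
    have "integrable (density lborel (\<lambda>x. ennreal (std_normal_density x))) (\<lambda>x. iexp (u * x))"
      using prob_space_normal_density[of 1 0]
      by (intro finite_measure.integrable_const_bound[where B=1] prob_space.finite_measure) auto
    then show ?thesis unfolding F_def by (subst (asm) integrable_density) auto
  qed
  have valF: "(LINT x|lborel. F x) = complex_of_real (exp (- (u\<^sup>2) / 2))"
  proof -
    have "(LINT x|lborel. F x) = char std_normal_distribution u"
      unfolding char_def F_def by (subst integral_density) auto
    then show ?thesis by (simp add: char_std_normal_distribution)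
  qed
  have eq: "complex_of_real (exp (- pi * (t * x\<^sup>2))) * cis (- 2 * pi * (x * k)) =
      complex_of_real (sqrt (2 * pi)) * F (0 + c * x)" for x
  proof -
    have "(c * x)\<^sup>2 / 2 = pi * (t * x\<^sup>2)" by (simp add: power_mult_distrib c2)
    moreover have "u * (c * x) = - 2 * pi * (x * k)" using c by (simp add: u_def)
    ultimately show ?thesis
      by (simp only: F_def std_normal_density_def cis_conv_exp scaleR_conv_of_real add_0) (simp add: power_divide flip: of_real_mult)
  qed
  show "integrable lborel (\<lambda>x. complex_of_real (exp (- pi * (t * x\<^sup>2))) * cis (- 2 * pi * (x * k)))"
    unfolding eq using lborel_integrable_real_affine[OF intF, of c 0] c by (intro integrable_mult_right) auto
  have "(LINT x|lborel. F x) = \<bar>c\<bar> *\<^sub>R (LINT x|lborel. F (0 + c * x))"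
    using c by (intro lborel_integral_real_affine) auto
  then have "(LINT x|lborel. F (0 + c * x)) = complex_of_real (exp (- (u\<^sup>2) / 2) / c)"
    using c valF by (simp add: scaleR_conv_of_real field_simps)
  moreover have "sqrt (2 * pi) * (exp (- (u\<^sup>2) / 2) / c) = exp (- pi * (k\<^sup>2 / t)) / sqrt t"
  proof -
    have "u\<^sup>2 / 2 = pi * (k\<^sup>2 / t)"
      using t by (simp add: u_def power_divide c2 power_mult_distrib) (simp add: power2_eq_square)
    moreover have "c = sqrt (2 * pi) * sqrt t" by (simp add: c_def real_sqrt_mult)
    ultimately show ?thesis by simp
  qed
  ultimately show "(LINT x|lborel. complex_of_real (exp (- pi * (t * x\<^sup>2))) * cis (- 2 * pi * (x * k))) =
      complex_of_real (exp (- pi * (k\<^sup>2 / t)) / sqrt t)"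
    unfolding eq by (simp flip: of_real_mult of_real_divide)
qed

lemma lborel_integral_prod:
  fixes f :: "'a::euclidean_space \<Rightarrow> real \<Rightarrow> complex"
  assumes f: "\<And>b. b \<in> Basis \<Longrightarrow> integrable lborel (f b)"
  shows "(LINT x|lborel. (\<Prod>b\<in>Basis. f b (x \<bullet> b))) = (\<Prod>b\<in>Basis. (LINT x|lborel. f b x))"
proof -
  interpret product_sigma_finite "\<lambda>_::'a. lborel :: real measure" by standard
  have [measurable]: "\<And>b. b \<in> Basis \<Longrightarrow> f b \<in> borel_measurable borel"
    using f by (auto dest: borel_measurable_integrable)
  have "(LINT x|lborel. (\<Prod>b\<in>Basis. f b (x \<bullet> b))) =
     (LINT x|distr (\<Pi>\<^sub>M b\<in>Basis. lborel) borel (\<lambda>g. \<Sum>b\<in>Basis. g b *\<^sub>R b). (\<Prod>b\<in>Basis. f b (x \<bullet> b)))"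
    by (subst lborel_eq) simp
  also have "\<dots> = (LINT g|(\<Pi>\<^sub>M b\<in>Basis. lborel). (\<Prod>b\<in>Basis. f b (g b)))"
    by (subst integral_distr) (auto intro!: Bochner_Integration.integral_cong prod.cong)
  also have "\<dots> = (\<Prod>b\<in>Basis. (LINT x|lborel. f b x))"
    using f by (intro product_integral_prod) auto
  finally show ?thesis .
qed

text \<open>Both the Gaussian and the character factorize over the coordinates, so the one-dimensional
  formula suffices.\<close>

lemma fourier_gauss:
  fixes d :: "'a::euclidean_space \<Rightarrow> real"
  assumes d: "\<And>b. b \<in> Basis \<Longrightarrow> 0 < d b"
  shows "fourier (\<lambda>x. complex_of_real (gauss d x)) \<xi> =
    complex_of_real ((\<Prod>b\<in>Basis. 1 / sqrt (d b)) * gauss (\<lambda>b. 1 / d b) \<xi>)"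
proof -
  define f where "f = (\<lambda>b x. complex_of_real (exp (- pi * (d b * x\<^sup>2))) * cis (- 2 * pi * (x * (\<xi> \<bullet> b))))"
  have cis_sum: "cis (\<Sum>b\<in>A. h b) = (\<Prod>b\<in>A. cis (h b))" if "finite A" for A :: "'a set" and h
    using that by (induction A rule: finite_induct) (auto simp flip: cis_mult)
  have "complex_of_real (gauss d x) * cis (- 2 * pi * (x \<bullet> \<xi>)) = (\<Prod>b\<in>Basis. f b (x \<bullet> b))" for x
  proof -
    have "complex_of_real (gauss d x) = (\<Prod>b\<in>Basis. complex_of_real (exp (- pi * (d b * (x \<bullet> b)\<^sup>2))))"
      by (simp add: gauss_def sum_distrib_left flip: exp_sum sum_negf of_real_prod)
    moreover have "cis (- 2 * pi * (x \<bullet> \<xi>)) = (\<Prod>b\<in>Basis. cis (- 2 * pi * ((x \<bullet> b) * (\<xi> \<bullet> b))))"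
      by (subst euclidean_inner[of x \<xi>]) (simp only: sum_distrib_left cis_sum finite_Basis)
    ultimately show ?thesis by (simp add: f_def prod.distrib)
  qed
  then have "fourier (\<lambda>x. complex_of_real (gauss d x)) \<xi> = (LINT x|lborel. (\<Prod>b\<in>Basis. f b (x \<bullet> b)))"
    unfolding fourier_def by simp
  also have "\<dots> = (\<Prod>b\<in>Basis. (LINT x|lborel. f b x))"
    using fourier_gauss_1(1)[OF d] by (intro lborel_integral_prod) (simp add: f_def)
  also have "\<dots> = (\<Prod>b\<in>Basis. complex_of_real (exp (- pi * ((\<xi> \<bullet> b)\<^sup>2 / d b)) / sqrt (d b)))"
    unfolding f_def using fourier_gauss_1(2)[OF d] by (intro prod.cong) auto
  also have "\<dots> = complex_of_real ((\<Prod>b\<in>Basis. 1 / sqrt (d b)) * gauss (\<lambda>b. 1 / d b) \<xi>)"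
    by (simp add: gauss_def sum_distrib_left prod_dividef exp_sum flip: sum_negf)
  finally show ?thesis .
qed

section \<open>Spheroidal stretchings and Gaussians\<close>

definition stretch :: "real \<Rightarrow> real \<Rightarrow> real^3 \<Rightarrow> real^3" where
  "stretch a b x = vector [a * x$1, a * x$2, b * x$3]"

definition spheroidal_gauss :: "real \<Rightarrow> real \<Rightarrow> real^3 \<Rightarrow> real" where
  "spheroidal_gauss p q x = exp (- pi * (p * ((x$1)\<^sup>2 + (x$2)\<^sup>2) + q * (x$3)\<^sup>2))"

lemma spheroidal_gauss_pos [simp]: "0 < spheroidal_gauss p q x"
  by (simp add: spheroidal_gauss_def)

lemma spheroidal_gauss_nonneg [simp]: "0 \<le> spheroidal_gauss p q x"
  by (simp add: spheroidal_gauss_def)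

lemma vec_nth_borel [measurable]: "(\<lambda>x::real^3. x $ i) \<in> borel_measurable borel"
  by (simp add: cart_eq_inner_axis)

lemma borel_measurable_spheroidal_gauss [measurable]: "spheroidal_gauss p q \<in> borel_measurable borel"
  unfolding spheroidal_gauss_def by measurable

lemma stretch_nth [simp]:
  "stretch a b x $ 1 = a * x$1" "stretch a b x $ 2 = a * x$2" "stretch a b x $ 3 = b * x$3"
  by (simp_all add: stretch_def)

lemma stretch_scaleR: "stretch a b (t *\<^sub>R x) = t *\<^sub>R stretch a b x"
  by (simp add: vec_eq_iff forall_3)

lemma stretch_diff: "stretch a b (x - y) = stretch a b x - stretch a b y"
  by (simp add: vec_eq_iff forall_3 algebra_simps)

lemma stretch_mult: "stretch (t * a) (t * b) x = t *\<^sub>R stretch a b x"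
  by (simp add: vec_eq_iff forall_3)

lemma norm_stretch_sq: "(norm (stretch a b x))\<^sup>2 = a\<^sup>2 * ((x$1)\<^sup>2 + (x$2)\<^sup>2) + b\<^sup>2 * (x$3)\<^sup>2"
  unfolding power2_norm_eq_inner inner_vec_def
  by (simp add: sum_3 power2_eq_square algebra_simps)

lemma norm_sq_3: "(norm (x::real^3))\<^sup>2 = (x$1)\<^sup>2 + (x$2)\<^sup>2 + (x$3)\<^sup>2"
  unfolding power2_norm_eq_inner inner_vec_def by (simp add: sum_3 power2_eq_square)

lemma norm_stretch_le:
  assumes "0 < a" "0 < b"
  shows "norm (stretch a b x) \<le> max a b * norm x"
proof (rule power2_le_imp_le)
  have "a\<^sup>2 \<le> (max a b)\<^sup>2" "b\<^sup>2 \<le> (max a b)\<^sup>2" using assms by (auto intro!: power_mono)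
  then have "a\<^sup>2 * ((x$1)\<^sup>2 + (x$2)\<^sup>2) + b\<^sup>2 * (x$3)\<^sup>2 \<le>
     (max a b)\<^sup>2 * ((x$1)\<^sup>2 + (x$2)\<^sup>2) + (max a b)\<^sup>2 * (x$3)\<^sup>2"
    by (intro add_mono mult_right_mono) auto
  then show "(norm (stretch a b x))\<^sup>2 \<le> (max a b * norm x)\<^sup>2"
    unfolding norm_stretch_sq power_mult_distrib norm_sq_3 by (simp add: algebra_simps)
  show "0 \<le> max a b * norm x" using assms by auto
qed

lemma stretch_inverse:
  assumes "0 < a" "0 < b"
  shows "stretch (1 / a) (1 / b) (stretch a b x) = x" "stretch a b (stretch (1 / a) (1 / b) x) = x"
  using assms by (simp_all add: vec_eq_iff forall_3)

lemma stretch_eq_0_iff: "0 < a \<Longrightarrow> 0 < b \<Longrightarrow> stretch a b x = 0 \<longleftrightarrow> x = 0"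
  by (auto simp add: vec_eq_iff forall_3)

text \<open>The diagonal entries \<open>(p, p, q)\<close>, indexed by basis vectors as \<^const>\<open>gauss\<close> and the
  affine change of variables on a Euclidean space expect.\<close>

definition axis_weight :: "real \<Rightarrow> real \<Rightarrow> real^3 \<Rightarrow> real" where
  "axis_weight p q u = (if u = axis 3 1 then q else p)"

lemma Basis_3: "(Basis :: (real^3) set) = {axis 1 1, axis 2 1, axis 3 1}"
  by (auto simp: Basis_vec_def UNIV_3)

lemma sum_Basis_3: "(\<Sum>u\<in>Basis. f (u::real^3)) = f (axis 1 1) + f (axis 2 1) + f (axis 3 1)"
  unfolding Basis_3 by (simp add: axis_eq_axis add.assoc)

lemma prod_Basis_3: "(\<Prod>u\<in>Basis. f (u::real^3)) = f (axis 1 1) * f (axis 2 1) * f (axis 3 1)"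
  unfolding Basis_3 by (simp add: axis_eq_axis mult.assoc)

lemma axis_weight_simps [simp]:
  "axis_weight p q (axis 1 1) = p" "axis_weight p q (axis 2 1) = p" "axis_weight p q (axis 3 1) = q"
  by (simp_all add: axis_weight_def axis_eq_axis)

lemma axis_weight_pos: "0 < p \<Longrightarrow> 0 < q \<Longrightarrow> 0 < axis_weight p q u"
  by (simp add: axis_weight_def)

lemma gauss_axis_weight: "gauss (axis_weight p q) = spheroidal_gauss p q"
  by (simp add: fun_eq_iff gauss_def spheroidal_gauss_def sum_Basis_3 inner_axis algebra_simps)

lemma stretch_measurable [measurable]: "stretch a b \<in> borel_measurable borel"
proof -
  have "stretch a b = (\<lambda>x. (a * x$1) *\<^sub>R axis 1 1 + (a * x$2) *\<^sub>R axis 2 1 + (b * x$3) *\<^sub>R axis 3 1)"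
    by (auto simp: fun_eq_iff vec_eq_iff forall_3 axis_def)
  then show ?thesis by simp
qed

lemma lborel_stretch:
  assumes "0 < a" "0 < b"
  shows "lborel = density (distr lborel borel (stretch a b)) (\<lambda>_. ennreal (a\<^sup>2 * b))"
proof -
  have "(\<lambda>x. 0 + (\<Sum>u\<in>Basis. (axis_weight a b u * (x \<bullet> u)) *\<^sub>R u)) = stretch a b"
    unfolding fun_eq_iff vec_eq_iff forall_3 sum_Basis_3 axis_weight_simps inner_axis
    by (simp add: axis_def)
  moreover have "(\<Prod>u\<in>Basis. \<bar>axis_weight a b u\<bar>) = a\<^sup>2 * b"
    using assms by (simp add: prod_Basis_3 power2_eq_square)
  ultimately show ?thesis
    using lborel_affine_euclidean[of "axis_weight a b" 0] assms by (simp add: axis_weight_def)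
qed

lemma nn_integral_stretch:
  assumes ab: "0 < a" "0 < b" and [measurable]: "f \<in> borel_measurable borel"
  shows "(\<integral>\<^sup>+x. f x \<partial>lborel) = ennreal (a\<^sup>2 * b) * (\<integral>\<^sup>+x. f (stretch a b x) \<partial>lborel)"
  by (subst lborel_stretch[OF ab]) (simp add: nn_integral_density nn_integral_distr nn_integral_cmult)

lemma fourier_spheroidal_gauss:
  assumes "0 < a" "0 < b"
  shows "fourier (\<lambda>x. complex_of_real (spheroidal_gauss (a\<^sup>2) (b\<^sup>2) x)) \<xi> =
     complex_of_real (1 / (a\<^sup>2 * b) * spheroidal_gauss (1 / a\<^sup>2) (1 / b\<^sup>2) \<xi>)"
proof -
  have "(\<lambda>u. 1 / axis_weight (a\<^sup>2) (b\<^sup>2) u) = axis_weight (1 / a\<^sup>2) (1 / b\<^sup>2)"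
    by (auto simp: axis_weight_def)
  then show ?thesis
    using fourier_gauss[of "axis_weight (a\<^sup>2) (b\<^sup>2)" \<xi>] assms axis_weight_pos[of "a\<^sup>2" "b\<^sup>2"]
    by (simp add: gauss_axis_weight prod_Basis_3 power2_eq_square)
qed

text \<open>Test functions in the defining identity of the Fourier transform are Gaussians, whose
  transforms are again Gaussians. After the substitution \<open>x \<mapsto> stretch a b x\<close> the side of \<open>f\<close>
  carries the dilated \<open>f\<close> against a fixed Gaussian, while on the side of \<open>g\<close> the parameters
  occur only linearly in an exponent. Measurability of \<open>f\<close> and \<open>g\<close> comes for free: the products
  with Gaussians are integrable, and Gaussians never vanish.\<close>

lemma tempered_fourier_gaussian_integral:
  fixes f g :: "real^3 \<Rightarrow> real"
  assumes F: "has_tempered_fourier (\<lambda>x. complex_of_real (f x)) (\<lambda>\<xi>. complex_of_real (g \<xi>))"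
    and nonneg: "\<And>x. 0 \<le> f x" "\<And>\<xi>. 0 \<le> g \<xi>"
  shows "f \<in> borel_measurable borel" "g \<in> borel_measurable borel"
    and "0 < a \<Longrightarrow> 0 < b \<Longrightarrow> (\<integral>\<^sup>+x. ennreal (f (stretch a b x) * spheroidal_gauss 1 1 x) \<partial>lborel) =
        (\<integral>\<^sup>+\<xi>. ennreal (g \<xi> * spheroidal_gauss (a\<^sup>2) (b\<^sup>2) \<xi>) \<partial>lborel)"
    and "0 < a \<Longrightarrow> 0 < b \<Longrightarrow> (\<integral>\<^sup>+\<xi>. ennreal (g \<xi> * spheroidal_gauss (a\<^sup>2) (b\<^sup>2) \<xi>) \<partial>lborel) < \<infinity>"
proof -
  have *: "integrable lborel (\<lambda>x. f x * (1 / (a\<^sup>2 * b) * spheroidal_gauss (1 / a\<^sup>2) (1 / b\<^sup>2) x))"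
    "integrable lborel (\<lambda>\<xi>. g \<xi> * spheroidal_gauss (a\<^sup>2) (b\<^sup>2) \<xi>)"
    "(LINT x|lborel. f x * (1 / (a\<^sup>2 * b) * spheroidal_gauss (1 / a\<^sup>2) (1 / b\<^sup>2) x)) =
      (LINT \<xi>|lborel. g \<xi> * spheroidal_gauss (a\<^sup>2) (b\<^sup>2) \<xi>)"
    if ab: "0 < a" "0 < b" for a b
  proof -
    have "schwartz (\<lambda>x. complex_of_real (spheroidal_gauss (a\<^sup>2) (b\<^sup>2) x))"
      using schwartz_gauss[of "axis_weight (a\<^sup>2) (b\<^sup>2)"] ab
      by (simp add: gauss_axis_weight) (simp add: axis_weight_def)
    from F[unfolded has_tempered_fourier_def, rule_format, OF this, unfolded fourier_spheroidal_gauss[OF ab]]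
    show "integrable lborel (\<lambda>x. f x * (1 / (a\<^sup>2 * b) * spheroidal_gauss (1 / a\<^sup>2) (1 / b\<^sup>2) x))"
      "integrable lborel (\<lambda>\<xi>. g \<xi> * spheroidal_gauss (a\<^sup>2) (b\<^sup>2) \<xi>)"
      "(LINT x|lborel. f x * (1 / (a\<^sup>2 * b) * spheroidal_gauss (1 / a\<^sup>2) (1 / b\<^sup>2) x)) =
        (LINT \<xi>|lborel. g \<xi> * spheroidal_gauss (a\<^sup>2) (b\<^sup>2) \<xi>)"
      unfolding of_real_mult[symmetric] integral_complex_of_real complex_of_real_integrable_eq of_real_eq_iff
      by blast+
  qed
  have "(\<lambda>x. f x * (1 / (1\<^sup>2 * 1) * spheroidal_gauss (1 / 1\<^sup>2) (1 / 1\<^sup>2) x) / spheroidal_gauss 1 1 x)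
      \<in> borel_measurable borel"
    using borel_measurable_integrable[OF *(1)[of 1 1]] by (intro borel_measurable_divide) auto
  then show f[measurable]: "f \<in> borel_measurable borel"
    by (simp add: less_imp_neq[OF spheroidal_gauss_pos, symmetric])
  have "(\<lambda>x. g x * spheroidal_gauss (1\<^sup>2) (1\<^sup>2) x / spheroidal_gauss 1 1 x) \<in> borel_measurable borel"
    using borel_measurable_integrable[OF *(2)[of 1 1]] by (intro borel_measurable_divide) auto
  then show "g \<in> borel_measurable borel"
    by (simp add: less_imp_neq[OF spheroidal_gauss_pos, symmetric])
  assume ab: "0 < a" "0 < b"
  have resc: "spheroidal_gauss (1 / a\<^sup>2) (1 / b\<^sup>2) (stretch a b x) = spheroidal_gauss 1 1 x" for x
    using ab by (simp add: spheroidal_gauss_def power_mult_distrib field_simps)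
  have "(\<integral>\<^sup>+\<xi>. ennreal (g \<xi> * spheroidal_gauss (a\<^sup>2) (b\<^sup>2) \<xi>) \<partial>lborel)
     = (\<integral>\<^sup>+x. ennreal (f x * (1 / (a\<^sup>2 * b) * spheroidal_gauss (1 / a\<^sup>2) (1 / b\<^sup>2) x)) \<partial>lborel)"
    using *[OF ab] nonneg ab by (simp add: nn_integral_eq_integral)
  also have "\<dots> = ennreal (a\<^sup>2 * b) * (\<integral>\<^sup>+x. ennreal (f (stretch a b x) * (1 / (a\<^sup>2 * b) * spheroidal_gauss 1 1 x)) \<partial>lborel)"
    by (subst nn_integral_stretch[OF ab]) (simp_all add: resc)
  also have "\<dots> = (\<integral>\<^sup>+x. ennreal (f (stretch a b x) * spheroidal_gauss 1 1 x) \<partial>lborel)"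
    using ab by (subst nn_integral_cmult[symmetric])
      (auto simp flip: ennreal_mult' intro!: nn_integral_cong)
  finally show "(\<integral>\<^sup>+x. ennreal (f (stretch a b x) * spheroidal_gauss 1 1 x) \<partial>lborel) =
        (\<integral>\<^sup>+\<xi>. ennreal (g \<xi> * spheroidal_gauss (a\<^sup>2) (b\<^sup>2) \<xi>) \<partial>lborel)" ..
  show "(\<integral>\<^sup>+\<xi>. ennreal (g \<xi> * spheroidal_gauss (a\<^sup>2) (b\<^sup>2) \<xi>) \<partial>lborel) < \<infinity>"
    using *(2)[OF ab] nonneg by (simp add: nn_integral_eq_integral)
qed

section \<open>Homogeneous functions against radial weights\<close>

lemma nn_integral_scaleR:
  fixes f :: "'a::euclidean_space \<Rightarrow> ennreal"
  assumes "0 < t" and [measurable]: "f \<in> borel_measurable borel"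
  shows "(\<integral>\<^sup>+x. f x \<partial>lborel) = ennreal (t ^ DIM('a)) * (\<integral>\<^sup>+x. f (t *\<^sub>R x) \<partial>lborel)"
  using assms(1) by (subst lborel_affine[of t 0])
    (simp_all add: nn_integral_density nn_integral_distr nn_integral_cmult)

lemma nn_integral_translate:
  fixes f :: "'a::euclidean_space \<Rightarrow> ennreal"
  assumes [measurable]: "f \<in> borel_measurable borel"
  shows "(\<integral>\<^sup>+x. f x \<partial>lborel) = (\<integral>\<^sup>+x. f (t + x) \<partial>lborel)"
  by (subst lborel_affine[of 1 t])
    (simp_all add: nn_integral_density nn_integral_distr nn_integral_cmult)

text \<open>For \<open>\<psi>\<close> homogeneous of degree 0, the image under the norm of the measure with density \<open>\<psi>\<close> gives
  \<open>{..<r}\<close> the mass \<open>r\<^sup>n\<close> times that of \<open>{..<1}\<close>, just as for \<open>\<psi> = 1\<close>. So both images agree up to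
  a constant factor, and this replaces polar coordinates.\<close>

lemma homogeneous_times_radial:
  fixes \<psi> :: "'a::euclidean_space \<Rightarrow> ennreal"
  assumes [measurable]: "\<psi> \<in> borel_measurable borel" "w \<in> borel_measurable borel"
    and hom: "\<And>t x. 0 < t \<Longrightarrow> \<psi> (t *\<^sub>R x) = \<psi> x"
    and fin: "(\<integral>\<^sup>+x\<in>ball 0 1. \<psi> x \<partial>lborel) < \<infinity>"
  shows "emeasure lborel (ball 0 1 :: 'a set) * (\<integral>\<^sup>+x. \<psi> x * w (norm x) \<partial>lborel) =
         (\<integral>\<^sup>+x\<in>ball 0 1. \<psi> x \<partial>lborel) * (\<integral>\<^sup>+x. w (norm (x::'a)) \<partial>lborel)"
proof -
  define v where "v = emeasure lborel (ball 0 1 :: 'a set)"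
  define m where "m = (\<integral>\<^sup>+x\<in>ball 0 1. \<psi> x \<partial>lborel)"
  define M where "M = scale_measure v (distr (density lborel \<psi>) borel norm)"
  define N where "N = scale_measure m (distr lborel borel (norm :: 'a \<Rightarrow> real))"
  have vfin: "v < \<infinity>" unfolding v_def by (rule emeasure_bounded_finite) simp
  have scale: "(\<integral>\<^sup>+x. k x * indicator {x. norm x < r} x \<partial>lborel) =
      ennreal (r ^ DIM('a)) * (\<integral>\<^sup>+x. k x * indicator (ball 0 1) x \<partial>lborel)"
    if "0 < r" and [measurable]: "k \<in> borel_measurable borel" and "\<And>t x. 0 < t \<Longrightarrow> k (t *\<^sub>R x) = k x"
    for r and k :: "'a \<Rightarrow> ennreal"
  proof -
    have "{x. norm x < r} = ball (0::'a) r" by (auto simp: ball_def)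
    then have [measurable]: "{x::'a. norm x < r} \<in> sets borel" by simp
    show ?thesis
      using that by (subst nn_integral_scaleR[OF that(1)])
        (auto intro!: arg_cong2[where f = "(*)"] nn_integral_cong simp: indicator_def)
  qed
  have emM: "emeasure M {..<r} = v * (\<integral>\<^sup>+x. \<psi> x * indicator {x. norm x < r} x \<partial>lborel)" for r
    unfolding M_def
    by (simp add: emeasure_distr emeasure_density vimage_def)
  have emN: "emeasure N {..<r} = m * (\<integral>\<^sup>+x. 1 * indicator {x::'a. norm x < r} x \<partial>lborel)" for r
    unfolding N_def by (simp add: emeasure_distr vimage_def)
  have eq: "emeasure M {..<r} = emeasure N {..<r}" for r
  proof (cases "0 < r")
    case True
    have "(\<integral>\<^sup>+x. 1 * indicator {x::'a. norm x < r} x \<partial>lborel) = ennreal (r ^ DIM('a)) * v"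
      using scale[OF True, of "\<lambda>_. 1"] by (simp add: v_def)
    then show ?thesis
      unfolding emM emN using scale[OF True _ hom] by (simp add: m_def mult_ac)
  next
    case False
    then have "{x::'a. norm x < r} = {}" using norm_ge_zero order.strict_trans1 by blast
    then show ?thesis unfolding emM emN by simp
  qed
  have "M = N"
  proof (rule measure_eqI_generator_eq[where E = "range lessThan" and \<Omega> = UNIV and A = "\<lambda>n. {..<real n}"])
    show "Int_stable (range lessThan :: real set set)"
    proof (rule Int_stableI, safe)
      fix r s :: real
      have "{..<r} \<inter> {..<s} = {..<min r s}" by auto
      then show "{..<r} \<inter> {..<s} \<in> range lessThan" by blast
    qed
    show "sets M = sigma_sets UNIV (range lessThan)" "sets N = sigma_sets UNIV (range lessThan)"
      by (simp_all add: M_def N_def borel_Iio)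
    show "(\<Union>i. {..<real i}) = UNIV" using reals_Archimedean2 by auto
    show "emeasure M {..<real i} \<noteq> \<infinity>" for i
    proof (cases "i = 0")
      case True
      then have "{x::'a. norm x < real i} = {}" by auto
      then show ?thesis unfolding emM by simp
    next
      case False
      then show ?thesis unfolding emM using scale[OF _ _ hom, of "real i"] vfin fin
        by (simp add: ennreal_mult_eq_top_iff less_top[symmetric])
    qed
  qed (use eq in auto)
  then have "(\<integral>\<^sup>+r. w r \<partial>M) = (\<integral>\<^sup>+r. w r \<partial>N)" by simp
  then show ?thesis
    unfolding M_def N_def v_def m_def
    by (simp add: nn_integral_scale_measure nn_integral_distr nn_integral_density)
qed

text \<open>Boxes determine Lebesgue measure, and orthogonal images of boxes keep their volume.\<close>

lemma nn_integral_orthogonal: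
  fixes T :: "real^3 \<Rightarrow> real^3" and f :: "real^3 \<Rightarrow> ennreal"
  assumes T: "orthogonal_transformation T" and [measurable]: "f \<in> borel_measurable borel"
  shows "(\<integral>\<^sup>+x. f x \<partial>lborel) = (\<integral>\<^sup>+x. f (T x) \<partial>lborel)"
proof -
  have "bounded_linear T" using orthogonal_transformation_linear[OF T] by (simp add: linear_linear)
  then have [measurable]: "T \<in> borel_measurable borel"
    by (simp add: linear_continuous_on borel_measurable_continuous_onI)
  have "lborel = distr lborel borel T"
  proof (rule lborel_eqI)
    fix l u :: "real^3" assume lu: "\<And>b. b \<in> Basis \<Longrightarrow> l \<bullet> b \<le> u \<bullet> b"
    have inv: "orthogonal_transformation (inv T)" by (rule orthogonal_transformation_inv[OF T])
    have pre: "T -` box l u = inv T ` box l u"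
      using orthogonal_transformation_bij[OF T] by (rule bij_vimage_eq_inv_image)
    have fin: "box l u \<in> lmeasurable" by simp
    have "emeasure (distr lborel borel T) (box l u) = emeasure lebesgue (inv T ` box l u)"
    proof -
      have "T -` box l u \<inter> space borel \<in> sets borel" by measurable
      then show ?thesis by (subst emeasure_distr) (simp_all add: pre[symmetric])
    qed
    also have "\<dots> = ennreal (measure lebesgue (inv T ` box l u))"
      using measurable_orthogonal_image[OF inv fin] by (simp add: emeasure_eq_measure2 fmeasurableD2)
    also have "\<dots> = ennreal (measure lebesgue (box l u))"
      by (simp add: measure_orthogonal_image[OF inv fin])
    also have "\<dots> = (\<Prod>b\<in>Basis. (u - l) \<bullet> b)"
      using lu by (simp add: measure_completion)
    finally show "emeasure (distr lborel borel T) (box l u) = (\<Prod>b\<in>Basis. (u - l) \<bullet> b)" .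
  qed simp
  then have "(\<integral>\<^sup>+x. f x \<partial>lborel) = (\<integral>\<^sup>+x. f x \<partial>distr lborel borel T)" by simp
  then show ?thesis by (simp add: nn_integral_distr)
qed

section \<open>A strictly convex minimization problem\<close>

text \<open>For \<open>g = |\<xi>|\<^sup>s\<^sup>-\<^sup>3 \<omega>t(\<xi>/|\<xi>|)\<close> this is, up to a constant factor, the interaction energy of the
  spheroid with squared half-axes proportional to \<open>p\<close>, \<open>p\<close>, \<open>q\<close>. The value \<open>\<infinity>\<close> is admitted so that
  the boundary cases \<open>p = 0\<close> and \<open>q = 0\<close> (needles and discs) are covered by the same formula.\<close>

definition gauss_moment :: "(real^3 \<Rightarrow> real) \<Rightarrow> real \<Rightarrow> real \<Rightarrow> ennreal" where
  "gauss_moment g p q = (\<integral>\<^sup>+\<xi>. ennreal (g \<xi> * spheroidal_gauss p q \<xi>) \<partial>lborel)"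

text \<open>The energy of a spheroid as a function of its squared half-axes: the confining potential
  \<open>|x|\<^sup>2\<close> contributes the linear term.\<close>

definition tilted_moment :: "real \<Rightarrow> real \<Rightarrow> real \<Rightarrow> (real^3 \<Rightarrow> real) \<Rightarrow> real \<Rightarrow> real \<Rightarrow> ennreal" where
  "tilted_moment \<kappa> m1 m2 g p q = ennreal \<kappa> * gauss_moment g p q + ennreal (m1 * p + m2 * q)"

lemma gauss_moment_lsc:
  assumes [measurable]: "g \<in> borel_measurable borel"
    and P: "P \<longlonglongrightarrow> p" and Q: "Q \<longlonglongrightarrow> q"
  shows "gauss_moment g p q \<le> liminf (\<lambda>n. gauss_moment g (P n) (Q n))"
proof -
  have "(\<lambda>n. ennreal (g \<xi> * spheroidal_gauss (P n) (Q n) \<xi>)) \<longlonglongrightarrow> ennreal (g \<xi> * spheroidal_gauss p q \<xi>)" for \<xi>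
    unfolding spheroidal_gauss_def by (intro tendsto_intros P Q)
  then have "liminf (\<lambda>n. ennreal (g \<xi> * spheroidal_gauss (P n) (Q n) \<xi>)) = ennreal (g \<xi> * spheroidal_gauss p q \<xi>)" for \<xi>
    by (intro lim_imp_Liminf) auto
  then have "gauss_moment g p q = (\<integral>\<^sup>+\<xi>. liminf (\<lambda>n. ennreal (g \<xi> * spheroidal_gauss (P n) (Q n) \<xi>)) \<partial>lborel)"
    by (simp add: gauss_moment_def)
  also have "\<dots> \<le> liminf (\<lambda>n. gauss_moment g (P n) (Q n))"
    unfolding gauss_moment_def by (rule nn_integral_liminf) measurable
  finally show ?thesis .
qed

text \<open>Lower semicontinuity up to the boundary, stated for a sequence whose values are dominated by a
  convergent sequence \<open>U\<close>: it is Fatou's lemma for the moment, the linear part being moved over to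
  the side of \<open>U\<close>.\<close>

lemma tilted_moment_lsc:
  assumes [measurable]: "g \<in> borel_measurable borel"
    and \<kappa>: "0 < \<kappa>" and m: "0 \<le> m1" "0 \<le> m2"
    and PQ0: "\<And>n. 0 \<le> P n" "\<And>n. 0 \<le> Q n"
    and P: "P \<longlonglongrightarrow> p" and Q: "Q \<longlonglongrightarrow> q"
    and le: "\<And>n. tilted_moment \<kappa> m1 m2 g (P n) (Q n) \<le> U n" and U: "U \<longlonglongrightarrow> u" and u: "u < \<infinity>"
  shows "tilted_moment \<kappa> m1 m2 g p q \<le> u"
proof -
  let ?L = "\<lambda>n. ennreal (m1 * P n + m2 * Q n)"
  have L: "?L \<longlonglongrightarrow> ennreal (m1 * p + m2 * q)" by (intro tendsto_intros P Q)
  have "?L n \<le> U n" for n using order_trans[OF _ le[of n]] by (simp add: tilted_moment_def)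
  then have Lu: "ennreal (m1 * p + m2 * q) \<le> u" by (intro LIMSEQ_le[OF L U]) auto
  have diff: "(\<lambda>n. U n - ?L n) \<longlonglongrightarrow> u - ennreal (m1 * p + m2 * q)"
    using u by (intro tendsto_diff_ennreal_general U L) auto
  have "ennreal \<kappa> * gauss_moment g p q \<le> u - ennreal (m1 * p + m2 * q)"
  proof -
    have scale: "gauss_moment (\<lambda>\<xi>. \<kappa> * g \<xi>) p q = ennreal \<kappa> * gauss_moment g p q" for p q
      unfolding gauss_moment_def using \<kappa> by (subst nn_integral_cmult[symmetric])
        (auto simp: mult.assoc ennreal_mult' intro!: nn_integral_cong)
    have "gauss_moment (\<lambda>\<xi>. \<kappa> * g \<xi>) p q \<le> liminf (\<lambda>n. gauss_moment (\<lambda>\<xi>. \<kappa> * g \<xi>) (P n) (Q n))"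
      by (intro gauss_moment_lsc P Q) measurable
    also have "\<dots> \<le> liminf (\<lambda>n. U n - ?L n)"
    proof (intro Liminf_mono always_eventually allI)
      fix n
      have "gauss_moment (\<lambda>\<xi>. \<kappa> * g \<xi>) (P n) (Q n) + ?L n \<le> U n"
        using le[of n] by (simp add: tilted_moment_def scale)
      then show "gauss_moment (\<lambda>\<xi>. \<kappa> * g \<xi>) (P n) (Q n) \<le> U n - ?L n"
        by (metis ennreal_add_diff_cancel_right ennreal_minus_mono ennreal_neq_top order_refl)
    qed
    also have "\<dots> = u - ennreal (m1 * p + m2 * q)" by (rule lim_imp_Liminf[OF _ diff]) simp
    finally show ?thesis unfolding scale .
  qed
  then have "ennreal \<kappa> * gauss_moment g p q + ennreal (m1 * p + m2 * q) \<le>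
      (u - ennreal (m1 * p + m2 * q)) + ennreal (m1 * p + m2 * q)" by (rule add_right_mono)
  then show ?thesis using Lu by (simp add: tilted_moment_def diff_add_cancel_ennreal)
qed

text \<open>The linear term makes sublevel sets bounded, so a subsequence converges in the closed quadrant;
  semicontinuity identifies the value at the limit.\<close>

lemma minimizing_subsequence:
  assumes g[measurable]: "g \<in> borel_measurable borel"
    and \<kappa>: "0 < \<kappa>" and m: "0 < m1" "0 < m2"
    and PQ0: "\<And>n. 0 \<le> P n" "\<And>n. 0 \<le> Q n"
    and le: "\<And>n. tilted_moment \<kappa> m1 m2 g (P n) (Q n) \<le> U n" and U: "U \<longlonglongrightarrow> u" and u: "u < \<infinity>"
  obtains r p q where "strict_mono (r :: nat \<Rightarrow> nat)" "(P \<circ> r) \<longlonglongrightarrow> p" "(Q \<circ> r) \<longlonglongrightarrow> q"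
    "0 \<le> p" "0 \<le> q" "tilted_moment \<kappa> m1 m2 g p q \<le> u"
proof -
  obtain B where B: "u < ennreal B" "0 \<le> B"
    using u by (metis ennreal_cases ennreal_less_iff infinity_ennreal_def less_irrefl lt_ex gt_ex order_le_less_trans order_less_imp_le)
  have "eventually (\<lambda>n. U n < ennreal B) sequentially" using order_tendstoD(2)[OF U B(1)] .
  then obtain N where N: "\<And>n. N \<le> n \<Longrightarrow> U n < ennreal B" by (auto simp: eventually_sequentially)
  have lin: "m1 * P n + m2 * Q n \<le> B" if "N \<le> n" for n
  proof -
    have "ennreal (m1 * P n + m2 * Q n) \<le> U n"
      using order_trans[OF _ le[of n]] by (simp add: tilted_moment_def)
    also have "\<dots> \<le> ennreal B" using N[OF that] by simp
    finally show ?thesis using B(2) by (simp add: ennreal_le_iff)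
  qed
  define X where "X n = (P (n + N), Q (n + N))" for n
  have "X n \<in> cbox (0, 0) (B / m1, B / m2)" for n
    using lin[of "n + N"] PQ0[of "n + N"] m
    by (auto simp: X_def cbox_Pair_eq field_simps intro: order_trans[rotated])
  then have "bounded (range X)" by (intro bounded_subset[OF bounded_cbox]) auto
  then obtain l r where r: "strict_mono (r :: nat \<Rightarrow> nat)" "(X \<circ> r) \<longlonglongrightarrow> l"
    using bounded_imp_convergent_subsequence by blast
  define r' where "r' n = r n + N" for n
  have r': "strict_mono r'" using r(1) by (auto simp: strict_mono_def r'_def)
  have Pl: "(P \<circ> r') \<longlonglongrightarrow> fst l" and Ql: "(Q \<circ> r') \<longlonglongrightarrow> snd l"
    using tendsto_fst[OF r(2)] tendsto_snd[OF r(2)] by (simp_all add: X_def r'_def o_def)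
  show thesis
  proof (rule that[OF r' Pl Ql])
    show "0 \<le> fst l" by (rule LIMSEQ_le_const[OF Pl]) (simp add: PQ0)
    show "0 \<le> snd l" by (rule LIMSEQ_le_const[OF Ql]) (simp add: PQ0)
    show "tilted_moment \<kappa> m1 m2 g (fst l) (snd l) \<le> u"
      by (rule tilted_moment_lsc[OF g \<kappa> _ _ _ _ Pl Ql _ LIMSEQ_subseq_LIMSEQ[OF U r'] u])
        (use m PQ0 le in \<open>simp_all add: less_imp_le\<close>)
  qed
qed

text \<open>Strict convexity of the exponential is inherited by the integral: the set where the two exponents
  differ is open and nonempty, hence not negligible, and \<open>g > 0\<close> there.\<close>

lemma gauss_moment_midpoint:
  assumes g[measurable]: "g \<in> borel_measurable borel" and pos: "\<And>\<xi>. \<xi> \<noteq> 0 \<Longrightarrow> 0 < g \<xi>" "0 \<le> g 0"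
    and ne: "(p, q) \<noteq> (p', q')"
    and fin: "gauss_moment g p q < \<infinity>" "gauss_moment g p' q' < \<infinity>"
  shows "gauss_moment g ((p + p') / 2) ((q + q') / 2) <
     ennreal (1/2) * gauss_moment g p q + ennreal (1/2) * gauss_moment g p' q'"
proof -
  define u where "u p q \<xi> = pi * (p * ((\<xi>$1)\<^sup>2 + (\<xi>$2)\<^sup>2) + q * (\<xi>$3)\<^sup>2)" for p q and \<xi> :: "real^3"
  have sg: "spheroidal_gauss p q \<xi> = exp (- u p q \<xi>)" for p q \<xi>
    by (simp add: u_def spheroidal_gauss_def)
  have umid: "u ((p + p') / 2) ((q + q') / 2) \<xi> = (u p q \<xi> + u p' q' \<xi>) / 2" for \<xi>
    by (simp add: u_def field_simps)
  have expid: "(exp (- x) + exp (- y)) / 2 - exp (- ((x + y) / 2)) = (exp (- x / 2) - exp (- y / 2))\<^sup>2 / 2" for x y :: real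
    by (simp add: power2_eq_square field_simps flip: exp_add)
  have conv: "exp (- ((x + y) / 2)) \<le> (exp (- x) + exp (- y)) / 2" for x y :: real
    using expid[of x y] zero_le_power2[of "exp (- x / 2) - exp (- y / 2)"] by linarith
  have strict: "exp (- ((x + y) / 2)) < (exp (- x) + exp (- y)) / 2" if "x \<noteq> y" for x y :: real
  proof -
    have "0 < (exp (- x / 2) - exp (- y / 2))\<^sup>2" using that by simp
    then show ?thesis using expid[of x y] by linarith
  qed
  have g0: "0 \<le> g \<xi>" for \<xi> using pos by (cases "\<xi> = 0") (auto intro: less_imp_le)
  let ?f = "\<lambda>\<xi>. ennreal (g \<xi> * spheroidal_gauss ((p + p') / 2) ((q + q') / 2) \<xi>)"
  let ?h = "\<lambda>\<xi>. ennreal (1/2) * ennreal (g \<xi> * spheroidal_gauss p q \<xi>) +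
      ennreal (1/2) * ennreal (g \<xi> * spheroidal_gauss p' q' \<xi>)"
  have h: "?h \<xi> = ennreal (g \<xi> * ((exp (- u p q \<xi>) + exp (- u p' q' \<xi>)) / 2))" for \<xi>
  proof -
    have half: "ennreal (1/2) * ennreal x = ennreal (1/2 * x)" for x by (rule ennreal_mult'[symmetric]) simp
    show ?thesis unfolding half using g0[of \<xi>]
      by (subst ennreal_plus[symmetric]) (auto simp: sg field_simps)
  qed
  have le: "?f \<xi> \<le> ?h \<xi>" for \<xi>
    unfolding h unfolding sg umid using conv g0 by (intro ennreal_leI mult_left_mono) auto
  have inth: "(\<integral>\<^sup>+\<xi>. ?h \<xi> \<partial>lborel) = ennreal (1/2) * gauss_moment g p q + ennreal (1/2) * gauss_moment g p' q'"
    unfolding gauss_moment_def by (simp add: nn_integral_add nn_integral_cmult)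
  have "(\<integral>\<^sup>+\<xi>. ?f \<xi> \<partial>lborel) < (\<integral>\<^sup>+\<xi>. ?h \<xi> \<partial>lborel)"
  proof (rule nn_integral_less)
    have "(\<integral>\<^sup>+\<xi>. ?f \<xi> \<partial>lborel) \<le> (\<integral>\<^sup>+\<xi>. ?h \<xi> \<partial>lborel)" by (intro nn_integral_mono le)
    also have "\<dots> < \<infinity>"
      unfolding inth using fin ennreal_less_top[of "1/2"] by (simp only: ennreal_mult_less_top ennreal_add_less_top infinity_ennreal_def) simp
    finally show "(\<integral>\<^sup>+\<xi>. ?f \<xi> \<partial>lborel) \<noteq> \<infinity>" by simp
    show "AE \<xi> in lborel. ?f \<xi> \<le> ?h \<xi>" using le by simp
    show "\<not> (AE \<xi> in lborel. ?h \<xi> \<le> ?f \<xi>)"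
    proof
      assume ae: "AE \<xi> in lborel. ?h \<xi> \<le> ?f \<xi>"
      define S where "S = {\<xi>. u p q \<xi> \<noteq> u p' q' \<xi>}"
      have "continuous_on UNIV (u p q)" for p q unfolding u_def by (intro continuous_intros)
      then have "open S" unfolding S_def by (intro open_Collect_neq)
      have "AE \<xi> in lborel. \<xi> \<notin> S"
        using ae AE_lborel_singleton[of 0]
      proof eventually_elim
        fix \<xi> :: "real^3" assume a: "?h \<xi> \<le> ?f \<xi>" "\<xi> \<noteq> 0"
        then have "g \<xi> * ((exp (- u p q \<xi>) + exp (- u p' q' \<xi>)) / 2) \<le> g \<xi> * exp (- ((u p q \<xi> + u p' q' \<xi>) / 2))"
          unfolding h unfolding sg umid using g0[of \<xi>] by (subst (asm) ennreal_le_iff) auto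
        then have "\<not> exp (- ((u p q \<xi> + u p' q' \<xi>) / 2)) < (exp (- u p q \<xi>) + exp (- u p' q' \<xi>)) / 2"
          using pos(1)[OF a(2)] by (simp add: not_less)
        then show "\<xi> \<notin> S" using strict unfolding S_def by blast
      qed
      moreover have "S \<in> sets borel" using \<open>open S\<close> by simp
      ultimately have "S \<in> null_sets lborel" by (subst AE_iff_null_sets) auto
      then have "negligible S"
        by (simp add: negligible_iff_null_sets null_sets_completionI)
      then have "S = {}" using open_not_negligible[OF \<open>open S\<close>] by blast
      then have "u p q (axis 1 1) = u p' q' (axis 1 1)" "u p q (axis 3 1) = u p' q' (axis 3 1)"
        unfolding S_def by auto
      then show False using ne by (simp add: u_def axis_def)
    qed
  qed measurable
  then show ?thesis unfolding inth gauss_moment_def .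
qed

lemma gauss_moment_gap:
  assumes [measurable]: "g \<in> borel_measurable borel" "S \<in> sets borel"
    and g0: "\<And>\<xi>. 0 \<le> g \<xi>" and pq: "p \<le> p'" "q \<le> q'" and K: "0 \<le> K"
    and gap: "\<And>\<xi>. \<xi> \<in> S \<Longrightarrow> K \<le> g \<xi> * (spheroidal_gauss p q \<xi> - spheroidal_gauss p' q' \<xi>)"
  shows "gauss_moment g p' q' + ennreal K * emeasure lborel S \<le> gauss_moment g p q"
proof -
  have "gauss_moment g p' q' + ennreal K * emeasure lborel S =
      (\<integral>\<^sup>+\<xi>. ennreal (g \<xi> * spheroidal_gauss p' q' \<xi>) + ennreal K * indicator S \<xi> \<partial>lborel)"
    unfolding gauss_moment_def by (subst nn_integral_add) (auto simp: nn_integral_cmult)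
  also have "\<dots> \<le> gauss_moment g p q"
    unfolding gauss_moment_def
  proof (intro nn_integral_mono)
    fix \<xi>
    have mono: "spheroidal_gauss p' q' \<xi> \<le> spheroidal_gauss p q \<xi>"
      unfolding spheroidal_gauss_def using pq by (simp add: add_mono mult_right_mono)
    have "ennreal (g \<xi> * spheroidal_gauss p' q' \<xi>) + ennreal K * indicator S \<xi> =
        ennreal (g \<xi> * spheroidal_gauss p' q' \<xi> + K * indicator S \<xi>)"
      using g0 K by (auto simp: indicator_def)
    also have "\<dots> \<le> ennreal (g \<xi> * spheroidal_gauss p q \<xi>)"
      using gap[of \<xi>] mult_left_mono[OF mono g0[of \<xi>]]
      by (intro ennreal_leI) (auto simp: indicator_def algebra_simps)
    finally show "ennreal (g \<xi> * spheroidal_gauss p' q' \<xi>) + ennreal K * indicator S \<xi>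
        \<le> ennreal (g \<xi> * spheroidal_gauss p q \<xi>)" .
  qed
  finally show ?thesis .
qed

text \<open>At a minimizer the loss of interaction energy from enlarging \<open>p\<close>, \<open>q\<close> cannot exceed the increase
  of the linear term. Restricting the integral to a test set \<open>S\<close> turns this into an inequality between
  numbers.\<close>

lemma minimizer_slope:
  assumes [measurable]: "g \<in> borel_measurable borel" "S \<in> sets borel"
    and g0: "\<And>\<xi>. 0 \<le> g \<xi>" and pq: "0 \<le> p" "0 \<le> q" "p \<le> p'" "q \<le> q'" and K: "0 \<le> K"
    and gap: "\<And>\<xi>. \<xi> \<in> S \<Longrightarrow> K \<le> g \<xi> * (spheroidal_gauss p q \<xi> - spheroidal_gauss p' q' \<xi>)"
    and vol: "emeasure lborel S = ennreal v" "0 \<le> v"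
    and \<kappa>: "0 < \<kappa>" and m: "0 < m1" "0 < m2"
    and fin: "tilted_moment \<kappa> m1 m2 g p q < \<infinity>"
    and min: "tilted_moment \<kappa> m1 m2 g p q \<le> tilted_moment \<kappa> m1 m2 g p' q'"
  shows "\<kappa> * K * v \<le> m1 * (p' - p) + m2 * (q' - q)"
proof -
  have gap': "gauss_moment g p' q' + ennreal (K * v) \<le> gauss_moment g p q"
    using gauss_moment_gap[OF assms(1,2) g0 pq(3,4) K gap] vol K by (simp add: ennreal_mult)
  have f: "gauss_moment g p q < \<infinity>" using fin \<kappa> by (auto simp: tilted_moment_def ennreal_mult_less_top)
  then have f': "gauss_moment g p' q' < \<infinity>" using gap'
    by (metis ennreal_add_eq_top infinity_ennreal_def less_top neq_top_trans)
  obtain x where x: "gauss_moment g p q = ennreal x" "0 \<le> x" using f by (cases "gauss_moment g p q") auto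
  obtain x' where x': "gauss_moment g p' q' = ennreal x'" "0 \<le> x'" using f' by (cases "gauss_moment g p' q'") auto
  have 1: "x' + K * v \<le> x" using gap' x x' K vol by (simp flip: ennreal_plus)
  have "\<kappa> * x + (m1 * p + m2 * q) \<le> \<kappa> * x' + (m1 * p' + m2 * q')"
    using min x x' \<kappa> m pq unfolding tilted_moment_def
    by (simp add: ennreal_le_iff flip: ennreal_mult' ennreal_plus)
  moreover have "\<kappa> * (x' + K * v) \<le> \<kappa> * x" using 1 \<kappa> by simp
  ultimately show ?thesis by (simp add: algebra_simps)
qed


lemma square_2_3: "(2::real)\<^sup>2 = 4" "(3::real)\<^sup>2 = 9" by simp_all

text \<open>If \<open>p\<close> is increased from 0, the integrand loses a fixed fraction where \<open>p(\<xi>\<^sub>1\<^sup>2 + \<xi>\<^sub>2\<^sup>2)\<close> is of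
  order 1. For \<open>p \<approx> n\<^sup>-\<^sup>2\<close> this happens on a box \<open>[n,2n]\<^sup>2 \<times> [-1,1]\<close>, where \<open>g\<close> is at least of order
  \<open>n\<^sup>s\<^sup>-\<^sup>3\<close>. So the interaction energy drops by at least the order \<open>n\<^sup>s\<^sup>-\<^sup>1\<close>, while the linear term pays
  only the order \<open>n\<^sup>-\<^sup>2\<close>: a contradiction for large \<open>n\<close>.\<close>

lemma minimizer_not_needle:
  assumes g[measurable]: "g \<in> borel_measurable borel"
    and s: "0 < s" "s < 3" and c: "0 < c" and lower: "\<And>\<xi>. c * norm \<xi> powr (s - 3) \<le> g \<xi>"
    and \<kappa>: "0 < \<kappa>" and m: "0 < m1" "0 < m2" and q: "0 \<le> q"
    and fin: "tilted_moment \<kappa> m1 m2 g 0 q < \<infinity>"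
    and min: "\<And>p'. 0 \<le> p' \<Longrightarrow> tilted_moment \<kappa> m1 m2 g 0 q \<le> tilted_moment \<kappa> m1 m2 g p' q"
  shows False
proof -
  have g0: "0 \<le> g \<xi>" for \<xi> using lower[of \<xi>] c by (smt (verit) mult_nonneg_nonneg powr_ge_zero)
  define C where "C = \<kappa> * c * exp (- pi * q) / 5"
  have C: "0 < C" using \<kappa> c by (simp add: C_def)
  have bound: "C * (2 * n\<^sup>2 * (3 * n) powr (s - 3)) \<le> m1 / (8 * pi * n\<^sup>2)" if n: "1 \<le> n" for n :: real
  proof -
    define S where "S = cbox (vector [n, n, -1]) (vector [2 * n, 2 * n, 1] :: real^3)"
    define K where "K = c * (3 * n) powr (s - 3) * (exp (- pi * q) / 5)"
    \<comment> \<open>so that \<open>1/4 \<le> pi p' (\<xi>\<^sub>1\<^sup>2 + \<xi>\<^sub>2\<^sup>2) \<le> 1\<close> on the box\<close>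
    define p' where "p' = 1 / (8 * pi * n\<^sup>2)"
    have "\<kappa> * K * (2 * n\<^sup>2) \<le> m1 * (p' - 0) + m2 * (q - q)"
    proof (rule minimizer_slope[where g = g and S = S])
      show "S \<in> sets borel" by (simp add: S_def)
      show "0 \<le> p'" "0 \<le> K" using c by (simp_all add: p'_def K_def)
      then show "tilted_moment \<kappa> m1 m2 g 0 q \<le> tilted_moment \<kappa> m1 m2 g p' q" by (intro min)
      show "emeasure lborel S = ennreal (2 * n\<^sup>2)"
        unfolding S_def using n
        by (subst emeasure_lborel_cbox) (auto simp: Basis_3 inner_axis axis_eq_axis power2_eq_square)
      fix \<xi> :: "real^3" assume "\<xi> \<in> S"
      then have x: "n \<le> \<xi>$1" "\<xi>$1 \<le> 2 * n" "n \<le> \<xi>$2" "\<xi>$2 \<le> 2 * n" "- 1 \<le> \<xi>$3" "\<xi>$3 \<le> 1"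
        by (auto simp: S_def mem_box_cart forall_3)
      have sq: "n\<^sup>2 \<le> (\<xi>$1)\<^sup>2" "(\<xi>$1)\<^sup>2 \<le> (2 * n)\<^sup>2" "n\<^sup>2 \<le> (\<xi>$2)\<^sup>2" "(\<xi>$2)\<^sup>2 \<le> (2 * n)\<^sup>2"
        using x n by (intro power_mono; simp)+
      have sq3: "(\<xi>$3)\<^sup>2 \<le> 1" using x by (simp add: abs_square_le_1 abs_le_iff)
      have n2: "1 \<le> n\<^sup>2" using n by simp
      have "\<xi> \<noteq> 0" using x n by auto
      have "norm \<xi> \<le> 3 * n"
      proof (rule power2_le_imp_le)
        show "(norm \<xi>)\<^sup>2 \<le> (3 * n)\<^sup>2"
          using sq(2,4) sq3 n2 unfolding norm_sq_3 power_mult_distrib square_2_3 by linarith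
        show "0 \<le> 3 * n" using n by simp
      qed
      then have 1: "c * (3 * n) powr (s - 3) \<le> g \<xi>"
        using powr_mono2'[of "s - 3" "norm \<xi>" "3 * n"] \<open>\<xi> \<noteq> 0\<close> s c
        by (intro order_trans[OF _ lower]) auto
      define y where "y = pi * p' * ((\<xi>$1)\<^sup>2 + (\<xi>$2)\<^sup>2)"
      have "pi * p' * (2 * n\<^sup>2) \<le> y" unfolding y_def using sq \<open>0 \<le> p'\<close> by (intro mult_left_mono) auto
      then have y: "1 / 4 \<le> y" using n by (simp add: p'_def)
      have "5 / 4 \<le> exp y" using exp_ge_add_one_self[of y] y by linarith
      then have "exp (- y) \<le> 4 / 5" by (simp add: exp_minus field_simps)
      then have "exp (- pi * q) * (1 / 5) \<le> exp (- pi * (q * (\<xi>$3)\<^sup>2)) * (1 - exp (- y))"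
        using sq3 q by (intro mult_mono) (auto simp: mult_left_le)
      also have "\<dots> = spheroidal_gauss 0 q \<xi> - spheroidal_gauss p' q \<xi>"
        by (simp add: spheroidal_gauss_def y_def algebra_simps flip: exp_add)
      finally have 2: "exp (- pi * q) / 5 \<le> spheroidal_gauss 0 q \<xi> - spheroidal_gauss p' q \<xi>" by simp
      show "K \<le> g \<xi> * (spheroidal_gauss 0 q \<xi> - spheroidal_gauss p' q \<xi>)"
        unfolding K_def using c g0 by (intro mult_mono 1 2) auto
    qed (use g g0 q \<kappa> m fin in auto)
    then show ?thesis by (simp add: K_def C_def p'_def algebra_simps)
  qed
  have "filterlim (\<lambda>n::real. C * (2 * n\<^sup>2 * (3 * n) powr (s - 3)) * n\<^sup>2) at_top at_top"
    using C s by real_asymp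
  then have "eventually (\<lambda>n::real. m1 < C * (2 * n\<^sup>2 * (3 * n) powr (s - 3)) * n\<^sup>2 \<and> 1 \<le> n) at_top"
    by (intro eventually_conj eventually_ge_at_top) (simp add: filterlim_at_top_dense)
  then obtain n :: real where n: "m1 < C * (2 * n\<^sup>2 * (3 * n) powr (s - 3)) * n\<^sup>2" "1 \<le> n"
    using eventually_happens by fastforce
  have "C * (2 * n\<^sup>2 * (3 * n) powr (s - 3)) * n\<^sup>2 \<le> m1 / (8 * pi * n\<^sup>2) * n\<^sup>2"
    by (intro mult_right_mono bound n) auto
  also have "\<dots> = m1 / (8 * pi)" using n by simp
  also have "\<dots> \<le> m1" using m pi_ge_two by (simp add: field_simps)
  finally show False using n by simp
qed

text \<open>The same comparison for \<open>q\<close>, with the boxes \<open>[0,1]\<^sup>2 \<times> [n,2n]\<close>: the drop is of order at least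
  \<open>n\<^sup>s\<^sup>-\<^sup>2\<close>, against a price of order \<open>n\<^sup>-\<^sup>2\<close>. This is where \<open>s > 0\<close> is essential.\<close>

lemma minimizer_not_disc:
  assumes g[measurable]: "g \<in> borel_measurable borel"
    and s: "0 < s" "s < 3" and c: "0 < c" and lower: "\<And>\<xi>. c * norm \<xi> powr (s - 3) \<le> g \<xi>"
    and \<kappa>: "0 < \<kappa>" and m: "0 < m1" "0 < m2" and p: "0 \<le> p"
    and fin: "tilted_moment \<kappa> m1 m2 g p 0 < \<infinity>"
    and min: "\<And>q'. 0 \<le> q' \<Longrightarrow> tilted_moment \<kappa> m1 m2 g p 0 \<le> tilted_moment \<kappa> m1 m2 g p q'"
  shows False
proof -
  have g0: "0 \<le> g \<xi>" for \<xi> using lower[of \<xi>] c by (smt (verit) mult_nonneg_nonneg powr_ge_zero)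
  define C where "C = \<kappa> * c * exp (- pi * (2 * p)) / 2"
  have C: "0 < C" using \<kappa> c by (simp add: C_def)
  have bound: "C * (n * (3 * n) powr (s - 3)) \<le> m2 / (pi * n\<^sup>2)" if n: "1 \<le> n" for n :: real
  proof -
    define S where "S = cbox (vector [0, 0, n]) (vector [1, 1, 2 * n] :: real^3)"
    define K where "K = c * (3 * n) powr (s - 3) * (exp (- pi * (2 * p)) / 2)"
    \<comment> \<open>so that \<open>pi q' \<xi>\<^sub>3\<^sup>2 \<ge> 1\<close> on the box\<close>
    define q' where "q' = 1 / (pi * n\<^sup>2)"
    have "\<kappa> * K * n \<le> m1 * (p - p) + m2 * (q' - 0)"
    proof (rule minimizer_slope[where g = g and S = S])
      show "S \<in> sets borel" by (simp add: S_def)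
      show "0 \<le> q'" "0 \<le> K" using c by (simp_all add: q'_def K_def)
      then show "tilted_moment \<kappa> m1 m2 g p 0 \<le> tilted_moment \<kappa> m1 m2 g p q'" by (intro min)
      show "emeasure lborel S = ennreal n"
        unfolding S_def using n
        by (subst emeasure_lborel_cbox) (auto simp: Basis_3 inner_axis axis_eq_axis)
      fix \<xi> :: "real^3" assume "\<xi> \<in> S"
      then have x: "0 \<le> \<xi>$1" "\<xi>$1 \<le> 1" "0 \<le> \<xi>$2" "\<xi>$2 \<le> 1" "n \<le> \<xi>$3" "\<xi>$3 \<le> 2 * n"
        by (auto simp: S_def mem_box_cart forall_3)
      have sq: "n\<^sup>2 \<le> (\<xi>$3)\<^sup>2" "(\<xi>$3)\<^sup>2 \<le> (2 * n)\<^sup>2" using x n by (intro power_mono; simp)+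
      have sq1: "(\<xi>$1)\<^sup>2 \<le> 1" "(\<xi>$2)\<^sup>2 \<le> 1" using x by (simp_all add: abs_square_le_1 abs_le_iff)
      have n2: "1 \<le> n\<^sup>2" using n by simp
      have "\<xi> \<noteq> 0" using x n by auto
      have "norm \<xi> \<le> 3 * n"
      proof (rule power2_le_imp_le)
        show "(norm \<xi>)\<^sup>2 \<le> (3 * n)\<^sup>2"
          using sq(2) sq1 n2 unfolding norm_sq_3 power_mult_distrib square_2_3 by linarith
        show "0 \<le> 3 * n" using n by simp
      qed
      then have 1: "c * (3 * n) powr (s - 3) \<le> g \<xi>"
        using powr_mono2'[of "s - 3" "norm \<xi>" "3 * n"] \<open>\<xi> \<noteq> 0\<close> s c
        by (intro order_trans[OF _ lower]) auto
      define y where "y = pi * q' * (\<xi>$3)\<^sup>2"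
      have "pi * q' * n\<^sup>2 \<le> y" unfolding y_def using sq \<open>0 \<le> q'\<close> by (intro mult_left_mono) auto
      then have y: "1 \<le> y" using n by (simp add: q'_def)
      have "2 \<le> exp y" using exp_ge_add_one_self[of y] y by linarith
      then have "exp (- y) \<le> 1 / 2" by (simp add: exp_minus field_simps)
      moreover have "p * ((\<xi>$1)\<^sup>2 + (\<xi>$2)\<^sup>2) \<le> p * 2" using sq1 p by (intro mult_left_mono) auto
      ultimately have "exp (- pi * (2 * p)) * (1 / 2) \<le> exp (- pi * (p * ((\<xi>$1)\<^sup>2 + (\<xi>$2)\<^sup>2))) * (1 - exp (- y))"
        by (intro mult_mono) auto
      also have "\<dots> = spheroidal_gauss p 0 \<xi> - spheroidal_gauss p q' \<xi>"
        by (simp add: spheroidal_gauss_def y_def algebra_simps flip: exp_add)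
      finally have 2: "exp (- pi * (2 * p)) / 2 \<le> spheroidal_gauss p 0 \<xi> - spheroidal_gauss p q' \<xi>" by simp
      show "K \<le> g \<xi> * (spheroidal_gauss p 0 \<xi> - spheroidal_gauss p q' \<xi>)"
        unfolding K_def using c g0 by (intro mult_mono 1 2) auto
    qed (use g g0 p \<kappa> m fin n in auto)
    then show ?thesis by (simp add: K_def C_def q'_def algebra_simps)
  qed
  have "filterlim (\<lambda>n::real. C * (n * (3 * n) powr (s - 3)) * n\<^sup>2) at_top at_top"
    using C s by real_asymp
  then have "eventually (\<lambda>n::real. m2 < C * (n * (3 * n) powr (s - 3)) * n\<^sup>2 \<and> 1 \<le> n) at_top"
    by (intro eventually_conj eventually_ge_at_top) (simp add: filterlim_at_top_dense)
  then obtain n :: real where n: "m2 < C * (n * (3 * n) powr (s - 3)) * n\<^sup>2" "1 \<le> n"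
    using eventually_happens by fastforce
  have "C * (n * (3 * n) powr (s - 3)) * n\<^sup>2 \<le> m2 / (pi * n\<^sup>2) * n\<^sup>2"
    by (intro mult_right_mono bound n) auto
  also have "\<dots> = m2 / pi" using n by simp
  also have "\<dots> \<le> m2" using m pi_ge_two by (simp add: field_simps)
  finally show False using n by simp
qed

lemma tendsto_if_unique_cluster_point:
  fixes X :: "nat \<Rightarrow> 'a::metric_space"
  assumes sub: "\<And>r :: nat \<Rightarrow> nat. strict_mono r \<Longrightarrow> \<exists>t. strict_mono (t :: nat \<Rightarrow> nat) \<and> (X \<circ> r \<circ> t) \<longlonglongrightarrow> l"
  shows "X \<longlonglongrightarrow> l"
proof (rule ccontr)
  assume "\<not> X \<longlonglongrightarrow> l"
  then obtain e where e: "0 < e" "\<And>N. \<exists>n\<ge>N. e \<le> dist (X n) l"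
    unfolding lim_sequentially by (auto simp: not_less)
  then have "infinite {n. e \<le> dist (X n) l}" by (auto simp: infinite_nat_iff_unbounded_le)
  then obtain r where r: "strict_mono (r :: nat \<Rightarrow> nat)" "\<And>n. e \<le> dist (X (r n)) l"
    using infinite_enumerate[of "{n. e \<le> dist (X n) l}"] by auto
  obtain t where "strict_mono (t :: nat \<Rightarrow> nat)" "(X \<circ> r \<circ> t) \<longlonglongrightarrow> l" using sub[OF r(1)] by blast
  then have "eventually (\<lambda>n. dist ((X \<circ> r \<circ> t) n) l < e) sequentially" using e(1) tendstoD by blast
  then show False using r(2) by (auto simp: eventually_sequentially not_less[symmetric])
qed

text \<open>Compactness and semicontinuity give a minimizer over the closed quadrant, strict convexity its
  uniqueness, and comparison with nearby spheroids excludes the boundary. A minimizing sequence then has the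
  minimizer as its only cluster point.\<close>

proposition tilted_moment_well_posed:
  assumes g[measurable]: "g \<in> borel_measurable borel"
    and s: "0 < s" "s < 3" and c: "0 < c" and lower: "\<And>\<xi>. c * norm \<xi> powr (s - 3) \<le> g \<xi>"
    and \<kappa>: "0 < \<kappa>" and m: "0 < m1" "0 < m2"
    and fin: "gauss_moment g 1 1 < \<infinity>"
  obtains p0 q0 where "0 < p0" "0 < q0"
    "\<forall>P Q U. (\<forall>n. 0 \<le> P n \<and> 0 \<le> Q n \<and> tilted_moment \<kappa> m1 m2 g (P n) (Q n) \<le> U n) \<longrightarrow>
       U \<longlonglongrightarrow> tilted_moment \<kappa> m1 m2 g p0 q0 \<longrightarrow> P \<longlonglongrightarrow> p0 \<and> Q \<longlonglongrightarrow> q0"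
proof -
  let ?J = "tilted_moment \<kappa> m1 m2 g"
  define i where "i = (INF (p, q)\<in>{0..} \<times> {0..}. ?J p q)"
  have i_le: "i \<le> ?J p q" if "0 \<le> p" "0 \<le> q" for p q
    unfolding i_def using that by (intro INF_lower2[of "(p, q)"]) auto
  have "?J 1 1 < \<infinity>" using fin by (simp add: tilted_moment_def ennreal_mult_less_top)
  then have ifin: "i < \<infinity>" using i_le[of 1 1] by (auto intro: le_less_trans)
  have g0: "0 \<le> g \<xi>" for \<xi> using lower[of \<xi>] c by (smt (verit) mult_nonneg_nonneg powr_ge_zero)
  have gpos: "0 < g \<xi>" if "\<xi> \<noteq> 0" for \<xi>
    using lower[of \<xi>] c that by (smt (verit) mult_pos_pos powr_gt_zero norm_eq_zero)
  have "\<exists>pq. 0 \<le> fst pq \<and> 0 \<le> snd pq \<and> ?J (fst pq) (snd pq) \<le> i + ennreal (1 / Suc n)" for n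
  proof -
    have "i < i + ennreal (1 / Suc n)" using ifin by (cases i) (simp_all add: ennreal_less_iff flip: ennreal_plus)
    then obtain x where "x \<in> {0..} \<times> {0..}" "(case x of (p, q) \<Rightarrow> ?J p q) < i + ennreal (1 / Suc n)"
      unfolding i_def INF_less_iff by blast
    then show ?thesis by (intro exI[of _ x]) (auto intro: less_imp_le)
  qed
  then obtain X where X: "\<And>n. 0 \<le> fst (X n)" "\<And>n. 0 \<le> snd (X n)"
    "\<And>n. ?J (fst (X n)) (snd (X n)) \<le> i + ennreal (1 / Suc n)" by metis
  have "(\<lambda>n. i + ennreal (1 / Suc n)) \<longlonglongrightarrow> i + ennreal 0"
    by (intro tendsto_intros LIMSEQ_Suc[OF lim_1_over_n])
  then have lim: "(\<lambda>n. i + ennreal (1 / Suc n)) \<longlonglongrightarrow> i" by simp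
  obtain p0 q0 where pq0: "0 \<le> p0" "0 \<le> q0" "?J p0 q0 \<le> i"
    by (rule minimizing_subsequence[OF g \<kappa> m X lim ifin])
  then have Ji: "?J p0 q0 = i" using i_le by (simp add: antisym)
  have p0: "p0 \<noteq> 0"
  proof
    assume "p0 = 0"
    with Ji have J0: "?J 0 q0 = i" by simp
    show False
      by (rule minimizer_not_needle[OF g s c lower \<kappa> m pq0(2)]) (simp_all add: J0 ifin[simplified] i_le pq0)
  qed
  have q0: "q0 \<noteq> 0"
  proof
    assume "q0 = 0"
    with Ji have J0: "?J p0 0 = i" by simp
    show False
      by (rule minimizer_not_disc[OF g s c lower \<kappa> m pq0(1)]) (simp_all add: J0 ifin[simplified] i_le pq0)
  qed
  have unique: "p = p0 \<and> q = q0" if pq: "0 \<le> p" "0 \<le> q" "?J p q \<le> i" for p q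
  proof (rule ccontr)
    assume ne: "\<not> (p = p0 \<and> q = q0)"
    have f: "gauss_moment g p q < \<infinity>" "gauss_moment g p0 q0 < \<infinity>"
      using pq(3) pq0(3) ifin \<kappa> by (auto simp: tilted_moment_def ennreal_mult_less_top dest!: le_less_trans)
    have mid: "gauss_moment g ((p + p0) / 2) ((q + q0) / 2) <
       ennreal (1/2) * gauss_moment g p q + ennreal (1/2) * gauss_moment g p0 q0"
      using ne f gpos g0 by (intro gauss_moment_midpoint) auto
    obtain x where x: "gauss_moment g p q = ennreal x" "0 \<le> x" using f by (cases "gauss_moment g p q") auto
    obtain y where y: "gauss_moment g p0 q0 = ennreal y" "0 \<le> y" using f by (cases "gauss_moment g p0 q0") auto
    have "gauss_moment g ((p + p0) / 2) ((q + q0) / 2) < ennreal ((x + y) / 2)"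
    proof -
      have half: "ennreal (1/2) * ennreal x = ennreal (1/2 * x)" for x by (rule ennreal_mult'[symmetric]) simp
      show ?thesis using mid x y unfolding x(1) y(1) half
        by (subst (asm) ennreal_plus[symmetric]) (auto simp: field_simps)
    qed
    then obtain z where z: "gauss_moment g ((p + p0) / 2) ((q + q0) / 2) = ennreal z" "0 \<le> z" "z < (x + y) / 2"
      by (cases "gauss_moment g ((p + p0) / 2) ((q + q0) / 2)") (auto simp: ennreal_less_iff)
    obtain j where j: "i = ennreal j" "0 \<le> j" using ifin by (cases i) auto
    have "\<kappa> * x + (m1 * p + m2 * q) \<le> j" "\<kappa> * y + (m1 * p0 + m2 * q0) \<le> j"
      using pq pq0 x y j \<kappa> m
      by (simp_all add: tilted_moment_def ennreal_le_iff flip: ennreal_mult' ennreal_plus)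
    moreover have "j \<le> \<kappa> * z + (m1 * ((p + p0) / 2) + m2 * ((q + q0) / 2))"
      using i_le[of "(p + p0) / 2" "(q + q0) / 2"] pq pq0 z j \<kappa> m
      by (simp add: tilted_moment_def ennreal_le_iff flip: ennreal_mult' ennreal_plus)
    moreover have "\<kappa> * z < \<kappa> * ((x + y) / 2)" using z \<kappa> by simp
    ultimately show False by (simp add: algebra_simps add_divide_distrib)
  qed
  show thesis
  proof (rule that)
    show "0 < p0" "0 < q0" using pq0 p0 q0 by auto
    show "\<forall>P Q U. (\<forall>n. 0 \<le> P n \<and> 0 \<le> Q n \<and> ?J (P n) (Q n) \<le> U n) \<longrightarrow>
       U \<longlonglongrightarrow> ?J p0 q0 \<longrightarrow> P \<longlonglongrightarrow> p0 \<and> Q \<longlonglongrightarrow> q0"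
    proof (intro allI impI)
      fix P Q :: "nat \<Rightarrow> real" and U
      assume "\<forall>n. 0 \<le> P n \<and> 0 \<le> Q n \<and> ?J (P n) (Q n) \<le> U n" and U: "U \<longlonglongrightarrow> ?J p0 q0"
      then have PQ: "\<And>n. 0 \<le> P n" "\<And>n. 0 \<le> Q n" "\<And>n. ?J (P n) (Q n) \<le> U n" by auto
      have "(\<lambda>n. (P n, Q n)) \<longlonglongrightarrow> (p0, q0)"
      proof (rule tendsto_if_unique_cluster_point)
        fix r :: "nat \<Rightarrow> nat" assume r: "strict_mono r"
        have "(U \<circ> r) \<longlonglongrightarrow> i" using LIMSEQ_subseq_LIMSEQ[OF U r] Ji by simp
        then obtain t p q where t: "strict_mono (t :: nat \<Rightarrow> nat)" "(P \<circ> r \<circ> t) \<longlonglongrightarrow> p" "(Q \<circ> r \<circ> t) \<longlonglongrightarrow> q"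
          "0 \<le> p" "0 \<le> q" "?J p q \<le> i"
          using PQ ifin by (elim minimizing_subsequence[OF g \<kappa> m, where P = "P \<circ> r" and Q = "Q \<circ> r", rotated 3]) auto
        then have "p = p0" "q = q0" using unique by auto
        with t show "\<exists>t. strict_mono (t :: nat \<Rightarrow> nat) \<and> ((\<lambda>n. (P n, Q n)) \<circ> r \<circ> t) \<longlonglongrightarrow> (p0, q0)"
          by (intro exI[of _ t]) (auto simp: o_def intro: tendsto_Pair)
      qed
      from tendsto_fst[OF this] tendsto_snd[OF this] show "P \<longlonglongrightarrow> p0 \<and> Q \<longlonglongrightarrow> q0" by simp
    qed
  qed
qed

section \<open>Energies of the spheroidal densities\<close>

text \<open>The density of the difference of two independent points with density \<open>r\<close>; every interaction
  energy of \<open>r\<close> is a single integral against it.\<close>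

definition autocorr :: "(real^3 \<Rightarrow> ennreal) \<Rightarrow> real^3 \<Rightarrow> ennreal" where
  "autocorr r z = (\<integral>\<^sup>+y. r (z + y) * r y \<partial>lborel)"

lemma borel_measurable_autocorr [measurable]:
  assumes [measurable]: "r \<in> borel_measurable borel"
  shows "autocorr r \<in> borel_measurable borel"
  unfolding autocorr_def by measurable

lemma pair_integral_autocorr:
  assumes [measurable]: "r \<in> borel_measurable borel" "H \<in> borel_measurable borel"
  shows "(\<integral>\<^sup>+x. r x * (\<integral>\<^sup>+y. r y * H (x - y) \<partial>lborel) \<partial>lborel) = (\<integral>\<^sup>+z. H z * autocorr r z \<partial>lborel)"
proof -
  have "(\<integral>\<^sup>+x. r x * (\<integral>\<^sup>+y. r y * H (x - y) \<partial>lborel) \<partial>lborel) =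
      (\<integral>\<^sup>+x. \<integral>\<^sup>+y. r x * (r y * H (x - y)) \<partial>lborel \<partial>lborel)"
    by (simp add: nn_integral_cmult)
  also have "\<dots> = (\<integral>\<^sup>+y. \<integral>\<^sup>+x. r x * (r y * H (x - y)) \<partial>lborel \<partial>lborel)"
    by (rule lborel_pair.Fubini') measurable
  also have "\<dots> = (\<integral>\<^sup>+y. \<integral>\<^sup>+z. r (y + z) * (r y * H z) \<partial>lborel \<partial>lborel)"
  proof (rule nn_integral_cong)
    fix y :: "real^3"
    show "(\<integral>\<^sup>+x. r x * (r y * H (x - y)) \<partial>lborel) = (\<integral>\<^sup>+z. r (y + z) * (r y * H z) \<partial>lborel)"
      using nn_integral_translate[of "\<lambda>x. r x * (r y * H (x - y))" y] by simp
  qed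
  also have "\<dots> = (\<integral>\<^sup>+z. \<integral>\<^sup>+y. r (y + z) * (r y * H z) \<partial>lborel \<partial>lborel)"
    by (rule lborel_pair.Fubini') measurable
  also have "\<dots> = (\<integral>\<^sup>+z. H z * autocorr r z \<partial>lborel)"
    unfolding autocorr_def
    by (subst nn_integral_cmult[symmetric]) (auto intro!: nn_integral_cong simp: add.commute mult_ac)
  finally show ?thesis .
qed

text \<open>Rotate \<open>z\<close> onto the first coordinate axis; the axis serves as the parametrization of radial
  functions by \<open>t \<ge> 0\<close>.\<close>

lemma autocorr_radial:
  assumes [measurable]: "r \<in> borel_measurable borel" and rad: "\<And>x y. norm x = norm y \<Longrightarrow> r x = r y"
  shows "autocorr r z = autocorr r (norm z *\<^sub>R axis 1 1)"
proof -
  have "norm (norm z *\<^sub>R axis 1 1 :: real^3) = norm z" by simp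
  then obtain T :: "real^3 \<Rightarrow> real^3" where T: "orthogonal_transformation T" "T (norm z *\<^sub>R axis 1 1) = z"
    by (rule orthogonal_transformation_exists)
  have lin: "linear T" by (rule orthogonal_transformation_linear[OF T(1)])
  have "autocorr r z = (\<integral>\<^sup>+y. r (T (norm z *\<^sub>R axis 1 1) + T y) * r (T y) \<partial>lborel)"
    unfolding autocorr_def T(2) by (rule nn_integral_orthogonal[OF T(1)]) measurable
  also have "\<dots> = autocorr r (norm z *\<^sub>R axis 1 1)"
    unfolding autocorr_def
  proof (intro nn_integral_cong arg_cong2[where f = "(*)"] rad)
    fix y
    show "norm (T (norm z *\<^sub>R axis 1 1) + T y) = norm (norm z *\<^sub>R axis 1 1 + y)"
      by (metis lin linear_add orthogonal_transformation_norm[OF T(1)])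
    show "norm (T y) = norm y" by (rule orthogonal_transformation_norm[OF T(1)])
  qed
  finally show ?thesis .
qed

lemma vec3_eq_stretch: "vector [x$1 / a, x$2 / a, x$3 / b] = stretch (1 / a) (1 / b) x"
  by (simp add: stretch_def)

lemma borel_measurable_rho3 [measurable]: "rho3 s \<in> borel_measurable borel"
  unfolding rho3_def by measurable

lemma nn_integral_rho_measure:
  assumes ab: "0 < a" "0 < b" and [measurable]: "F \<in> borel_measurable borel"
  shows "(\<integral>\<^sup>+x. F x \<partial>rho_measure s a b) = (\<integral>\<^sup>+x. ennreal (rho3 s x) * F (stretch a b x) \<partial>lborel)"
proof -
  have [measurable]: "rho_ab s a b \<in> borel_measurable borel"
    unfolding rho_ab_def vec3_eq_stretch by measurable
  have "(\<integral>\<^sup>+x. F x \<partial>rho_measure s a b) = (\<integral>\<^sup>+x. ennreal (rho_ab s a b x) * F x \<partial>lborel)"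
    unfolding rho_measure_def by (rule nn_integral_density) measurable
  also have "\<dots> = ennreal (a\<^sup>2 * b) * (\<integral>\<^sup>+x. ennreal (rho_ab s a b (stretch a b x)) * F (stretch a b x) \<partial>lborel)"
    by (rule nn_integral_stretch[OF ab]) measurable
  also have "\<dots> = (\<integral>\<^sup>+x. ennreal (rho3 s x) * F (stretch a b x) \<partial>lborel)"
  proof -
    have "ennreal (a\<^sup>2 * b) * (ennreal (rho_ab s a b (stretch a b x)) * F (stretch a b x)) =
        ennreal (rho3 s x) * F (stretch a b x)" for x
      unfolding rho_ab_def vec3_eq_stretch stretch_inverse[OF ab] mult.assoc[symmetric]
      using ab by (simp flip: ennreal_mult')
    then show ?thesis by (subst nn_integral_cmult[symmetric]) auto
  qed
  finally show ?thesis .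
qed

lemma borel_prob_rho_measure_iff:
  assumes "0 < a" "0 < b"
  shows "borel_prob (rho_measure s a b) \<longleftrightarrow> (\<integral>\<^sup>+x. ennreal (rho3 s x) \<partial>lborel) = 1"
proof -
  have "emeasure (rho_measure s a b) (space (rho_measure s a b)) = (\<integral>\<^sup>+x. 1 \<partial>rho_measure s a b)"
    by simp
  also have "\<dots> = (\<integral>\<^sup>+x. ennreal (rho3 s x) \<partial>lborel)"
    using nn_integral_rho_measure[OF assms, of "\<lambda>_. 1"] by simp
  finally have e: "emeasure (rho_measure s a b) (space (rho_measure s a b)) = (\<integral>\<^sup>+x. ennreal (rho3 s x) \<partial>lborel)" .
  show ?thesis
    unfolding borel_prob_def using e
    by (auto simp: rho_measure_def prob_space.emeasure_space_1 intro!: prob_spaceI dest: prob_space.emeasure_space_1)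
qed

text \<open>All measures of the family are linear images of one fixed density, so the energy only sees the
  potential composed with the linear map.\<close>

lemma energy_rho_measure:
  assumes ab: "0 < a" "0 < b" and [measurable]: "W \<in> borel_measurable borel"
  shows "energy W (rho_measure s a b) =
     (\<integral>\<^sup>+z. W (stretch a b z) * autocorr (\<lambda>x. ennreal (rho3 s x)) z \<partial>lborel) / 2"
proof -
  have inner: "(\<integral>\<^sup>+y. W (x - y) \<partial>rho_measure s a b) =
      (\<integral>\<^sup>+y. ennreal (rho3 s y) * W (x - stretch a b y) \<partial>lborel)" for x
    by (rule nn_integral_rho_measure[OF ab]) measurable
  have "(\<integral>\<^sup>+x. (\<integral>\<^sup>+y. W (x - y) \<partial>rho_measure s a b) \<partial>rho_measure s a b) =
     (\<integral>\<^sup>+x. ennreal (rho3 s x) * (\<integral>\<^sup>+y. ennreal (rho3 s y) * W (stretch a b x - stretch a b y) \<partial>lborel) \<partial>lborel)"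
    unfolding inner by (rule nn_integral_rho_measure[OF ab]) measurable
  also have "\<dots> = (\<integral>\<^sup>+z. W (stretch a b z) * autocorr (\<lambda>x. ennreal (rho3 s x)) z \<partial>lborel)"
    unfolding stretch_diff[symmetric] by (rule pair_integral_autocorr) measurable
  finally show ?thesis by (simp add: energy_def)
qed

lemma nn_integral_autocorr:
  assumes [measurable]: "r \<in> borel_measurable borel"
  shows "(\<integral>\<^sup>+z. autocorr r z \<partial>lborel) = (\<integral>\<^sup>+x. r x \<partial>lborel) * (\<integral>\<^sup>+x. r x \<partial>lborel)"
  using pair_integral_autocorr[OF assms, of "\<lambda>_. 1"] by (simp add: nn_integral_multc)

lemma nn_integral_weighted_pos:
  fixes h R :: "real^3 \<Rightarrow> ennreal"
  assumes [measurable]: "h \<in> borel_measurable borel" "R \<in> borel_measurable borel"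
    and pos: "AE x in lborel. h x \<noteq> 0" and R: "(\<integral>\<^sup>+z. R z \<partial>lborel) \<noteq> 0"
  shows "(\<integral>\<^sup>+z. h z * R z \<partial>lborel) \<noteq> 0"
proof
  assume "(\<integral>\<^sup>+z. h z * R z \<partial>lborel) = 0"
  then have "AE z in lborel. h z * R z = 0" by (simp add: nn_integral_0_iff_AE)
  with pos have "AE z in lborel. R z = 0" by eventually_elim auto
  then have "(\<integral>\<^sup>+z. R z \<partial>lborel) = 0" by (subst nn_integral_0_iff_AE) auto
  with R show False ..
qed

lemma AE_component_nonzero: "AE x in lborel. (x :: real^3) $ k \<noteq> 0"
proof -
  have "negligible {x :: real^3. x $ k = 0}" by (rule negligible_standard_hyperplane_cart)
  then have "{x :: real^3. x $ k = 0} \<in> null_sets lebesgue" by (simp add: negligible_iff_null_sets)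
  moreover have "{x :: real^3. x $ k = 0} \<in> sets lborel" by simp
  ultimately have "{x :: real^3. x $ k = 0} \<in> null_sets lborel"
    by (simp only: null_sets_completion_iff)
  from AE_not_in[OF this] show ?thesis by simp
qed

text \<open>Integrating a function homogeneous of degree \<open>-s\<close> against two radial weights gives proportional
  results, with a constant that depends only on \<open>s\<close> and the weights. Hence the weight coming from the density
  can be traded for a Gaussian, simultaneously for all stretchings of \<open>f\<close>. Finiteness of the
  constant needs one nonzero finite Gaussian integral, which rules out that the radial integral \<open>B\<close>
  diverges.\<close>

lemma homogeneous_radial_ratio:
  fixes f :: "real^3 \<Rightarrow> real" and R :: "real^3 \<Rightarrow> ennreal"
  assumes [measurable]: "f \<in> borel_measurable borel" "R \<in> borel_measurable borel"
    and f0: "\<And>x. 0 \<le> f x" and hom: "\<And>t x. 0 < t \<Longrightarrow> f (t *\<^sub>R x) = t powr (- s) * f x"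
    and s: "0 < s"
    and rad: "\<And>z. R z = R (norm z *\<^sub>R axis 1 1)"
    and R0: "(\<integral>\<^sup>+z. R z \<partial>lborel) \<noteq> 0"
    and NR: "(\<integral>\<^sup>+z. ennreal (norm z powr (- s)) * R z \<partial>lborel) < \<infinity>"
    and gfin: "\<And>a b. 0 < a \<Longrightarrow> 0 < b \<Longrightarrow> (\<integral>\<^sup>+x. ennreal (f (stretch a b x) * spheroidal_gauss 1 1 x) \<partial>lborel) < \<infinity>"
    and gpos: "\<And>a b. 0 < a \<Longrightarrow> 0 < b \<Longrightarrow> (\<integral>\<^sup>+x. ennreal (f (stretch a b x) * spheroidal_gauss 1 1 x) \<partial>lborel) \<noteq> 0"
  obtains \<kappa> where "0 < \<kappa>" "\<And>a b. 0 < a \<Longrightarrow> 0 < b \<Longrightarrow>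
    (\<integral>\<^sup>+z. ennreal (f (stretch a b z)) * R z \<partial>lborel) =
    ennreal \<kappa> * (\<integral>\<^sup>+x. ennreal (f (stretch a b x) * spheroidal_gauss 1 1 x) \<partial>lborel)"
proof -
  define v where "v = emeasure lborel (ball 0 1 :: (real^3) set)"
  define A where "A = (\<integral>\<^sup>+z. ennreal (norm z powr (- s)) * R z \<partial>lborel)"
  define B where "B = (\<integral>\<^sup>+z. ennreal (norm (z::real^3) powr (- s) * exp (- pi * (norm z)\<^sup>2)) \<partial>lborel)"
  define M where "M a b = (\<integral>\<^sup>+x\<in>ball 0 1. ennreal (norm x powr s * f (stretch a b x)) \<partial>lborel)" for a b
  let ?V = "\<lambda>a b. \<integral>\<^sup>+z. ennreal (f (stretch a b z)) * R z \<partial>lborel"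
  let ?G = "\<lambda>a b. \<integral>\<^sup>+x. ennreal (f (stretch a b x) * spheroidal_gauss 1 1 x) \<partial>lborel"
  have sg: "spheroidal_gauss 1 1 x = exp (- pi * (norm x)\<^sup>2)" for x
    by (simp add: spheroidal_gauss_def norm_sq_3)
  have vpos: "v \<noteq> 0" unfolding v_def using content_ball_pos[of 1 "0::real^3"]
    by (auto simp: measure_def)
  have vfin: "v < \<infinity>" unfolding v_def by (rule emeasure_bounded_finite) simp
  have Apos: "A \<noteq> 0" unfolding A_def
  proof (rule nn_integral_weighted_pos)
    show "AE x in lborel. ennreal (norm (x::real^3) powr - s) \<noteq> 0"
      using AE_lborel_singleton[of 0] by eventually_elim auto
  qed (use R0 in auto)
  have key: "v * ?V a b = M a b * A" "v * ?G a b = M a b * B" if ab: "0 < a" "0 < b" for a b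
  proof -
    have Mfin: "M a b < \<infinity>"
    proof -
      have "M a b \<le> (\<integral>\<^sup>+x. ennreal (exp pi) * ennreal (f (stretch a b x) * spheroidal_gauss 1 1 x) \<partial>lborel)"
        unfolding M_def
      proof (rule nn_integral_mono)
        fix x :: "real^3"
        show "ennreal (norm x powr s * f (stretch a b x)) * indicator (ball 0 1) x \<le>
            ennreal (exp pi) * ennreal (f (stretch a b x) * spheroidal_gauss 1 1 x)"
        proof (cases "norm x < 1")
          case True
          have "norm x powr s \<le> 1" using True s by (intro powr_le1) auto
          moreover have "1 \<le> exp pi * spheroidal_gauss 1 1 x"
            using True unfolding sg mult_exp_exp by (simp add: power_le_one mult_left_le)
          ultimately have "norm x powr s \<le> exp pi * spheroidal_gauss 1 1 x" by linarith
          then have "norm x powr s * f (stretch a b x) \<le> (exp pi * spheroidal_gauss 1 1 x) * f (stretch a b x)"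
            by (rule mult_right_mono) (rule f0)
          then have "ennreal (norm x powr s * f (stretch a b x)) \<le> ennreal (exp pi * (f (stretch a b x) * spheroidal_gauss 1 1 x))"
            by (intro ennreal_leI) (simp add: mult_ac)
          then show ?thesis using True by (simp flip: ennreal_mult')
        qed simp
      qed
      also have "\<dots> = ennreal (exp pi) * ?G a b" by (rule nn_integral_cmult) measurable
      also have "\<dots> < \<infinity>" using gfin[OF ab] by (simp add: ennreal_mult_less_top)
      finally show ?thesis .
    qed
    have hom0: "ennreal (norm (t *\<^sub>R x) powr s * f (stretch a b (t *\<^sub>R x))) = ennreal (norm x powr s * f (stretch a b x))"
      if "0 < t" for t x
      using that by (simp add: stretch_scaleR hom powr_mult powr_minus field_simps)
    note radial = homogeneous_times_radial[of "\<lambda>x. ennreal (norm x powr s * f (stretch a b x))", OF _ _ hom0 Mfin[unfolded M_def],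
        folded v_def M_def]
    have "v * (\<integral>\<^sup>+x. ennreal (norm x powr s * f (stretch a b x)) * (ennreal (norm x powr (- s)) * R (norm x *\<^sub>R axis 1 1)) \<partial>lborel)
       = M a b * (\<integral>\<^sup>+x. ennreal (norm (x::real^3) powr (- s)) * R (norm x *\<^sub>R axis 1 1) \<partial>lborel)"
      by (rule radial[where w = "\<lambda>t. ennreal (t powr (- s)) * R (t *\<^sub>R axis 1 1)"]) measurable
    also have "(\<integral>\<^sup>+x. ennreal (norm x powr s * f (stretch a b x)) * (ennreal (norm x powr (- s)) * R (norm x *\<^sub>R axis 1 1)) \<partial>lborel)
      = ?V a b"
    proof (rule nn_integral_cong_AE)
      show "AE x in lborel. ennreal (norm x powr s * f (stretch a b x)) * (ennreal (norm x powr (- s)) * R (norm x *\<^sub>R axis 1 1)) =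
          ennreal (f (stretch a b x)) * R x"
        using AE_lborel_singleton[of 0]
      proof eventually_elim
        fix x :: "real^3" assume "x \<noteq> 0"
        then have eq: "norm x powr s * f (stretch a b x) * norm x powr (- s) = f (stretch a b x)"
          by (simp add: powr_minus field_simps)
        have "ennreal (norm x powr s * f (stretch a b x)) * ennreal (norm x powr (- s)) = ennreal (f (stretch a b x))"
          unfolding ennreal_mult''[OF powr_ge_zero, symmetric] eq ..
        then show "ennreal (norm x powr s * f (stretch a b x)) * (ennreal (norm x powr (- s)) * R (norm x *\<^sub>R axis 1 1)) =
          ennreal (f (stretch a b x)) * R x" by (simp add: rad[symmetric] mult.assoc[symmetric])
      qed
    qed
    finally show "v * ?V a b = M a b * A" by (simp add: A_def rad[symmetric])
    have "v * (\<integral>\<^sup>+x. ennreal (norm x powr s * f (stretch a b x)) * ennreal (norm x powr (- s) * exp (- pi * (norm x)\<^sup>2)) \<partial>lborel)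
       = M a b * B" unfolding B_def
      by (rule radial[where w = "\<lambda>t. ennreal (t powr (- s) * exp (- pi * t\<^sup>2))"]) measurable
    also have "(\<integral>\<^sup>+x. ennreal (norm x powr s * f (stretch a b x)) * ennreal (norm x powr (- s) * exp (- pi * (norm x)\<^sup>2)) \<partial>lborel)
      = ?G a b"
    proof (rule nn_integral_cong_AE)
      show "AE x in lborel. ennreal (norm x powr s * f (stretch a b x)) * ennreal (norm x powr (- s) * exp (- pi * (norm x)\<^sup>2)) =
          ennreal (f (stretch a b x) * spheroidal_gauss 1 1 x)"
        using AE_lborel_singleton[of 0]
      proof eventually_elim
        fix x :: "real^3" assume "x \<noteq> 0"
        then have eq: "norm x powr s * f (stretch a b x) * (norm x powr (- s) * exp (- pi * (norm x)\<^sup>2)) =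
            f (stretch a b x) * spheroidal_gauss 1 1 x"
          by (simp add: powr_minus field_simps sg)
        have "ennreal (norm x powr s * f (stretch a b x)) * ennreal (norm x powr (- s) * exp (- pi * (norm x)\<^sup>2)) =
          ennreal (norm x powr s * f (stretch a b x) * (norm x powr (- s) * exp (- pi * (norm x)\<^sup>2)))"
          by (rule ennreal_mult''[symmetric]) simp
        then show "ennreal (norm x powr s * f (stretch a b x)) * ennreal (norm x powr (- s) * exp (- pi * (norm x)\<^sup>2)) =
          ennreal (f (stretch a b x) * spheroidal_gauss 1 1 x)" unfolding eq .
      qed
    qed
    finally show "v * ?G a b = M a b * B" .
  qed
  have B: "B \<noteq> 0" "B < \<infinity>"
  proof -
    have G: "?G 1 1 \<noteq> 0" "?G 1 1 < \<infinity>" using gpos[of 1 1] gfin[of 1 1] by auto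
    have "v * ?G 1 1 \<noteq> 0" "v * ?G 1 1 < \<infinity>"
      using vpos vfin G by (simp_all add: ennreal_mult_less_top)
    then show "B \<noteq> 0" "B < \<infinity>" unfolding key(2)[OF zero_less_one zero_less_one]
      by (auto simp: ennreal_mult_less_top)
  qed
  define \<kappa> where "\<kappa> = enn2real A / enn2real B"
  have A: "A < \<infinity>" using NR by (simp add: A_def)
  have "0 < \<kappa>" unfolding \<kappa>_def using A B Apos
    by (simp add: enn2real_positive_iff zero_less_iff_neq_zero less_top)
  moreover have "?V a b = ennreal \<kappa> * ?G a b" if ab: "0 < a" "0 < b" for a b
  proof -
    have eqB: "ennreal \<kappa> * B = A" unfolding \<kappa>_def using A B
      by (cases A; cases B) (auto simp flip: ennreal_mult')
    have "v * ?V a b = M a b * (ennreal \<kappa> * B)" unfolding eqB by (rule key(1)[OF ab])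
    also have "\<dots> = ennreal \<kappa> * (M a b * B)" by (rule mult.left_commute)
    also have "\<dots> = v * (ennreal \<kappa> * ?G a b)"
      unfolding key(2)[OF ab, symmetric] by (rule mult.left_commute)
    finally show ?thesis using vpos vfin by (auto simp: ennreal_mult_cancel_left)
  qed
  ultimately show thesis by (rule that)
qed

lemma emeasure_rho_measure_singleton: "emeasure (rho_measure s a b) {x} = 0"
proof -
  have [measurable]: "rho_ab s a b \<in> borel_measurable borel"
    unfolding rho_ab_def vec3_eq_stretch by measurable
  have "AE y in lborel. y \<in> {x} \<longrightarrow> ennreal (rho_ab s a b y) = 0"
    using AE_lborel_singleton[of x] by eventually_elim simp
  then have "{x} \<in> null_sets (rho_measure s a b)"
    unfolding rho_measure_def by (subst null_sets_density_iff) auto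
  then show ?thesis by (simp add: null_sets_def)
qed

text \<open>If the minimal energy were infinite, all probability measures would be minimizers, among them a
  point mass, which is not a translate of an atomless measure.\<close>

lemma unique_minimizer_finite_energy:
  assumes min: "unique_energy_minimizer W \<mu>" and atomless: "\<And>x. emeasure \<mu> {x} = 0"
  shows "energy W \<mu> < \<infinity>"
proof (rule ccontr)
  assume "\<not> energy W \<mu> < \<infinity>"
  then have top: "energy W \<mu> = \<infinity>" by (metis infinity_ennreal_def less_top)
  have \<mu>: "borel_prob \<mu>" "\<And>\<nu>. borel_prob \<nu> \<Longrightarrow> energy W \<mu> \<le> energy W \<nu>"
    using min by (auto simp: unique_energy_minimizer_def energy_minimizer_def)
  define \<delta> where "\<delta> = return borel (0::'a)"
  have "borel_prob \<delta>" by (auto simp: \<delta>_def borel_prob_def intro: prob_space_return)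
  moreover have "energy W \<nu> = \<infinity>" if "borel_prob \<nu>" for \<nu>
    using \<mu>(2)[OF that] top by (simp add: top_unique)
  ultimately have "energy_minimizer W \<delta>" by (simp add: energy_minimizer_def)
  then obtain t where t: "\<delta> = distr \<mu> borel (\<lambda>x. x + t)"
    using min by (auto simp: unique_energy_minimizer_def)
  have sets: "sets \<mu> = sets borel" using \<mu>(1) by (simp add: borel_prob_def)
  then have [measurable]: "(\<lambda>x. x + t) \<in> measurable \<mu> borel"
    by (simp add: measurable_cong_sets[OF sets refl])
  have "emeasure \<delta> {0} = emeasure \<mu> ((\<lambda>x. x + t) -` {0} \<inter> space \<mu>)"
    unfolding t by (rule emeasure_distr) auto
  also have "(\<lambda>x. x + t) -` {0} \<inter> space \<mu> = {- t}"
    using sets_eq_imp_space_eq[OF sets] by (auto simp: eq_neg_iff_add_eq_0)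
  finally show False using atomless[of "- t"] by (simp add: \<delta>_def)
qed

lemma norm_stretch_powr_le:
  assumes ab: "0 < a" "0 < b" "0 < a'" "0 < b'" and s: "0 < s"
  shows "norm (stretch a' b' z) powr (- s) \<le> max (a / a') (b / b') powr s * norm (stretch a b z) powr (- s)"
proof (cases "z = 0")
  case True
  then show ?thesis using ab by (simp add: stretch_eq_0_iff[THEN iffD2])
next
  case False
  let ?m = "max (a / a') (b / b')"
  have pos: "0 < norm (stretch a b z)" "0 < norm (stretch a' b' z)" "0 < ?m"
    using False ab by (auto simp: stretch_eq_0_iff less_max_iff_disj)
  have "stretch (a / a') (b / b') (stretch a' b' z) = stretch a b z"
    using ab by (simp add: vec_eq_iff forall_3)
  then have "norm (stretch a b z) \<le> ?m * norm (stretch a' b' z)"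
    using norm_stretch_le[of "a / a'" "b / b'" "stretch a' b' z"] ab by simp
  then have "norm (stretch a b z) powr s \<le> (?m * norm (stretch a' b' z)) powr s"
    using s by (intro powr_mono2) auto
  also have "\<dots> = ?m powr s * norm (stretch a' b' z) powr s" using pos by (simp add: powr_mult)
  finally show ?thesis using pos by (simp add: powr_minus field_simps)
qed

text \<open>The four parts of the energy: isotropic repulsion, anisotropic repulsion, and the two second
  moments. The origin, where the potential is infinite, is a null set for the difference of two
  points.\<close>

lemma energy_potential_rho_measure:
  fixes s :: real and \<omega> :: "real^3 \<Rightarrow> real"
  defines "f \<equiv> \<lambda>x. norm x powr (- s) * \<omega> (sgn x)"
    and "R \<equiv> autocorr (\<lambda>x. ennreal (rho3 s x))"
  assumes ab: "0 < a" "0 < b" and \<alpha>: "0 < \<alpha>" and f0: "\<And>x. 0 \<le> f x"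
    and [measurable]: "f \<in> borel_measurable borel"
  shows "energy (potential s (\<lambda>u. 1 + \<alpha> * \<omega> u)) (rho_measure s a b) =
    ((\<integral>\<^sup>+z. ennreal (norm (stretch a b z) powr (- s)) * R z \<partial>lborel) +
     ennreal \<alpha> * (\<integral>\<^sup>+z. ennreal (f (stretch a b z)) * R z \<partial>lborel) +
     (ennreal (a\<^sup>2) * (\<integral>\<^sup>+z. ennreal ((z$1)\<^sup>2 + (z$2)\<^sup>2) * R z \<partial>lborel) +
      ennreal (b\<^sup>2) * (\<integral>\<^sup>+z. ennreal ((z$3)\<^sup>2) * R z \<partial>lborel))) / 2"
proof -
  let ?W = "potential s (\<lambda>u. 1 + \<alpha> * \<omega> u)"
  have W: "?W = (\<lambda>x. if x = 0 then \<infinity> else ennreal (norm x powr (- s) + \<alpha> * f x + (norm x)\<^sup>2))"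
    by (auto simp: fun_eq_iff potential_def f_def algebra_simps)
  have Wm: "?W \<in> borel_measurable borel" unfolding W by measurable
  have [measurable]: "R \<in> borel_measurable borel" unfolding R_def by measurable
  have "(\<integral>\<^sup>+z. ?W (stretch a b z) * R z \<partial>lborel) =
    (\<integral>\<^sup>+z. ennreal (norm (stretch a b z) powr (- s)) * R z + ennreal \<alpha> * (ennreal (f (stretch a b z)) * R z) +
      (ennreal (a\<^sup>2) * (ennreal ((z$1)\<^sup>2 + (z$2)\<^sup>2) * R z) + ennreal (b\<^sup>2) * (ennreal ((z$3)\<^sup>2) * R z)) \<partial>lborel)"
  proof (rule nn_integral_cong_AE)
    show "AE z in lborel. ?W (stretch a b z) * R z = ennreal (norm (stretch a b z) powr (- s)) * R z +
      ennreal \<alpha> * (ennreal (f (stretch a b z)) * R z) +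
      (ennreal (a\<^sup>2) * (ennreal ((z$1)\<^sup>2 + (z$2)\<^sup>2) * R z) + ennreal (b\<^sup>2) * (ennreal ((z$3)\<^sup>2) * R z))"
      using AE_lborel_singleton[of 0]
    proof eventually_elim
      fix z :: "real^3" assume "z \<noteq> 0"
      then have "?W (stretch a b z) = ennreal (norm (stretch a b z) powr (- s) + \<alpha> * f (stretch a b z) +
          (a\<^sup>2 * ((z$1)\<^sup>2 + (z$2)\<^sup>2) + b\<^sup>2 * (z$3)\<^sup>2))"
        using stretch_eq_0_iff[OF ab] by (simp add: W norm_stretch_sq)
      also have "\<dots> = ennreal (norm (stretch a b z) powr (- s)) + ennreal \<alpha> * ennreal (f (stretch a b z)) +
          (ennreal (a\<^sup>2) * ennreal ((z$1)\<^sup>2 + (z$2)\<^sup>2) + ennreal (b\<^sup>2) * ennreal ((z$3)\<^sup>2))"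
        using f0 \<alpha> by (simp add: less_imp_le flip: ennreal_mult' ennreal_plus)
      finally show "?W (stretch a b z) * R z = ennreal (norm (stretch a b z) powr (- s)) * R z +
          ennreal \<alpha> * (ennreal (f (stretch a b z)) * R z) +
          (ennreal (a\<^sup>2) * (ennreal ((z$1)\<^sup>2 + (z$2)\<^sup>2) * R z) + ennreal (b\<^sup>2) * (ennreal ((z$3)\<^sup>2) * R z))"
        by (simp only: distrib_right mult.assoc)
    qed
  qed
  also have "\<dots> = (\<integral>\<^sup>+z. ennreal (norm (stretch a b z) powr (- s)) * R z \<partial>lborel) +
     ennreal \<alpha> * (\<integral>\<^sup>+z. ennreal (f (stretch a b z)) * R z \<partial>lborel) +
     (ennreal (a\<^sup>2) * (\<integral>\<^sup>+z. ennreal ((z$1)\<^sup>2 + (z$2)\<^sup>2) * R z \<partial>lborel) +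
      ennreal (b\<^sup>2) * (\<integral>\<^sup>+z. ennreal ((z$3)\<^sup>2) * R z \<partial>lborel))"
    by (simp add: nn_integral_add nn_integral_cmult del: ennreal_plus)
  finally show ?thesis
    unfolding energy_rho_measure[OF ab Wm] R_def[symmetric] by simp
qed

section \<open>Scaling of the optimal half-axes\<close>

theorem theorem5p4:
  fixes s c :: real
    and \<omega> \<omega>t :: "real^3 \<Rightarrow> real"
    and a b :: "real \<Rightarrow> real"
  assumes s: "0 < s" "s < 3"
    and smooth: "smooth_on_sphere \<omega>"
    and nonneg: "\<And>x. x \<in> sphere 0 1 \<Longrightarrow> 0 \<le> \<omega> x"
    and even: "\<And>x. x \<in> sphere 0 1 \<Longrightarrow> \<omega> (- x) = \<omega> x"
    and axisym: "axisymmetric3 \<omega>"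
    and angle: "is_fourier_angle s \<omega> \<omega>t"
    and c: "0 < c" "\<And>\<xi>. \<xi> \<in> sphere 0 1 \<Longrightarrow> c \<le> \<omega>t \<xi>"
    and pair: "\<And>\<alpha>. 0 < \<alpha> \<Longrightarrow> 0 < a \<alpha> \<and> 0 < b \<alpha> \<and>
       unique_energy_minimizer (potential s (\<lambda>u. 1 + \<alpha> * \<omega> u)) (rho_measure s (a \<alpha>) (b \<alpha>))"
  shows "(\<exists>A>0. ((\<lambda>\<alpha>. a \<alpha> * \<alpha> powr (- 1 / (2 + s))) \<longlongrightarrow> A) at_top) \<and>
         (\<exists>B>0. ((\<lambda>\<alpha>. b \<alpha> * \<alpha> powr (- 1 / (2 + s))) \<longlongrightarrow> B) at_top)"
proof -
  define f where "f = (\<lambda>x. norm x powr (- s) * \<omega> (sgn x))"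
  define g where "g = (\<lambda>\<xi>. norm \<xi> powr (s - 3) * \<omega>t (sgn \<xi>))"
  have F: "has_tempered_fourier (\<lambda>x. complex_of_real (f x)) (\<lambda>\<xi>. complex_of_real (g \<xi>))"
    using angle by (simp add: is_fourier_angle_def f_def g_def)
  have sgn_sphere: "sgn x \<in> sphere 0 1" if "x \<noteq> 0" for x :: "real^3"
    using that by (simp add: norm_sgn)
  have f0: "0 \<le> f x" for x using nonneg[OF sgn_sphere[of x]] by (cases "x = 0") (auto simp: f_def)
  have lower: "c * norm \<xi> powr (s - 3) \<le> g \<xi>" for \<xi>
    using c(2)[OF sgn_sphere[of \<xi>]] by (cases "\<xi> = 0") (auto simp: g_def intro: mult_left_mono)
  have g0: "0 \<le> g \<xi>" for \<xi> using lower[of \<xi>] c(1) by (smt (verit) mult_nonneg_nonneg powr_ge_zero)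
  have gpos: "0 < g \<xi>" if "\<xi> \<noteq> 0" for \<xi>
    using lower[of \<xi>] c(1) that by (smt (verit) mult_pos_pos powr_gt_zero norm_eq_zero)
  have hom: "f (t *\<^sub>R x) = t powr (- s) * f x" if "0 < t" for t x
    using that by (simp add: f_def powr_mult sgn_scaleR)
  note gaussian = tempered_fourier_gaussian_integral[OF F f0 g0]
  note [measurable] = gaussian(1,2)
  have moment_fin: "gauss_moment g (x\<^sup>2) (y\<^sup>2) < \<infinity>" if "0 < x" "0 < y" for x y
    using gaussian(4)[OF that] by (simp add: gauss_moment_def)
  have moment_pos: "gauss_moment g p q \<noteq> 0" for p q
  proof -
    have "(\<integral>\<^sup>+\<xi>. ennreal (g \<xi> * spheroidal_gauss p q \<xi>) * 1 \<partial>lborel) \<noteq> 0"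
    proof (rule nn_integral_weighted_pos)
      show "AE \<xi> in lborel. ennreal (g \<xi> * spheroidal_gauss p q \<xi>) \<noteq> 0"
        using AE_lborel_singleton[of 0]
        by eventually_elim (simp add: ennreal_eq_0_iff gpos not_le)
    qed auto
    then show ?thesis by (simp add: gauss_moment_def)
  qed

  define R where "R = autocorr (\<lambda>x. ennreal (rho3 s x))"
  have R_meas[measurable]: "R \<in> borel_measurable borel" unfolding R_def by measurable
  have R_rad: "R z = R (norm z *\<^sub>R axis 1 1)" for z
    unfolding R_def by (rule autocorr_radial) (auto simp: rho3_def)
  define N where "N x y = (\<integral>\<^sup>+z. ennreal (norm (stretch x y z) powr (- s)) * R z \<partial>lborel)" for x y
  define V where "V x y = (\<integral>\<^sup>+z. ennreal (f (stretch x y z)) * R z \<partial>lborel)" for x y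
  define M1 where "M1 = (\<integral>\<^sup>+z. ennreal ((z$1)\<^sup>2 + (z$2)\<^sup>2) * R z \<partial>lborel)"
  define M2 where "M2 = (\<integral>\<^sup>+z. ennreal ((z$3)\<^sup>2) * R z \<partial>lborel)"
  define E where "E \<alpha> x y = N x y + ennreal \<alpha> * V x y + (ennreal (x\<^sup>2) * M1 + ennreal (y\<^sup>2) * M2)" for \<alpha> x y
  have energy_E: "energy (potential s (\<lambda>u. 1 + \<alpha> * \<omega> u)) (rho_measure s x y) = E \<alpha> x y / 2"
    if "0 < x" "0 < y" "0 < \<alpha>" for x y \<alpha>
    using energy_potential_rho_measure[OF that, of s \<omega>] f0 gaussian(1)
    unfolding E_def N_def V_def M1_def M2_def R_def f_def by simp
  have ab: "0 < a \<alpha>" "0 < b \<alpha>" if "0 < \<alpha>" for \<alpha> using pair[OF that] by auto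
  have ab1: "0 < a 1" "0 < b 1" by (simp_all add: ab)
  have mass: "(\<integral>\<^sup>+x. ennreal (rho3 s x) \<partial>lborel) = 1"
    using pair[OF zero_less_one] borel_prob_rho_measure_iff[OF ab1, of s]
    by (auto simp: unique_energy_minimizer_def energy_minimizer_def)
  have minE: "E \<alpha> (a \<alpha>) (b \<alpha>) \<le> E \<alpha> x y" if "0 < \<alpha>" "0 < x" "0 < y" for \<alpha> x y
  proof -
    have "borel_prob (rho_measure s x y)" using borel_prob_rho_measure_iff[OF that(2,3)] mass by blast
    then have "energy (potential s (\<lambda>u. 1 + \<alpha> * \<omega> u)) (rho_measure s (a \<alpha>) (b \<alpha>)) \<le>
        energy (potential s (\<lambda>u. 1 + \<alpha> * \<omega> u)) (rho_measure s x y)"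
      using pair[OF that(1)] by (auto simp: unique_energy_minimizer_def energy_minimizer_def)
    then have "E \<alpha> (a \<alpha>) (b \<alpha>) / 2 \<le> E \<alpha> x y / 2"
      using energy_E that ab[OF that(1)] by simp
    moreover have "2 * (X / 2) = X" for X :: ennreal
      unfolding ennreal_times_divide mult.commute[of 2] by (rule ennreal_mult_divide_eq) auto
    ultimately show ?thesis by (metis mult_left_mono zero_le)
  qed
  \<comment> \<open>One finite energy makes all integrals below finite, since stretchings change them by bounded factors.\<close>
  have "energy (potential s (\<lambda>u. 1 + 1 * \<omega> u)) (rho_measure s (a 1) (b 1)) < \<infinity>"
    by (rule unique_minimizer_finite_energy[OF conjunct2[OF conjunct2[OF pair[OF zero_less_one]]]
        emeasure_rho_measure_singleton])
  then have "E 1 (a 1) (b 1) / 2 < \<infinity>" unfolding energy_E[OF ab1 zero_less_one] .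
  then have "E 1 (a 1) (b 1) \<noteq> \<infinity>" by (auto simp: ennreal_top_divide)
  then have fin1: "N (a 1) (b 1) < \<infinity>" "ennreal ((a 1)\<^sup>2) * M1 < \<infinity>" "ennreal ((b 1)\<^sup>2) * M2 < \<infinity>"
    by (auto simp: E_def less_top)
  have R0: "(\<integral>\<^sup>+z. R z \<partial>lborel) \<noteq> 0" unfolding R_def by (subst nn_integral_autocorr) (simp_all add: mass)
  have "M1 < \<infinity>" "M2 < \<infinity>" using fin1(2,3) ab[of 1] by (auto simp: ennreal_mult_less_top ennreal_eq_0_iff)
  moreover have "M1 \<noteq> 0" unfolding M1_def
  proof (rule nn_integral_weighted_pos[OF _ _ _ R0])
    show "AE x in lborel. ennreal (((x::real^3)$1)\<^sup>2 + (x$2)\<^sup>2) \<noteq> 0"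
      using AE_component_nonzero[of 1] by eventually_elim (simp add: ennreal_eq_0_iff sum_power2_le_zero_iff del: ennreal_plus)
  qed measurable
  moreover have "M2 \<noteq> 0" unfolding M2_def
  proof (rule nn_integral_weighted_pos[OF _ _ _ R0])
    show "AE x in lborel. ennreal (((x::real^3)$3)\<^sup>2) \<noteq> 0"
      using AE_component_nonzero[of 3] by eventually_elim (simp add: ennreal_eq_0_iff)
  qed measurable
  ultimately obtain m1 m2 where m: "M1 = ennreal m1" "0 < m1" "M2 = ennreal m2" "0 < m2"
    by (cases M1; cases M2) (auto simp: less_le)

  have N_le: "N x y < \<infinity>" if xy: "0 < x" "0 < y" for x y
  proof -
    let ?k = "max (a 1 / x) (b 1 / y) powr s"
    have "N x y \<le> (\<integral>\<^sup>+z. ennreal ?k * (ennreal (norm (stretch (a 1) (b 1) z) powr (- s)) * R z) \<partial>lborel)"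
      unfolding N_def
    proof (rule nn_integral_mono)
      fix z
      have "ennreal (norm (stretch x y z) powr (- s)) \<le> ennreal (?k * norm (stretch (a 1) (b 1) z) powr (- s))"
        using norm_stretch_powr_le[OF ab1 xy s(1)] by (intro ennreal_leI) simp
      then show "ennreal (norm (stretch x y z) powr (- s)) * R z \<le>
          ennreal ?k * (ennreal (norm (stretch (a 1) (b 1) z) powr (- s)) * R z)"
        unfolding ennreal_mult''[OF powr_ge_zero] mult.assoc[symmetric] by (rule mult_right_mono) simp
    qed
    also have "\<dots> = ennreal ?k * N (a 1) (b 1)"
      unfolding N_def by (rule nn_integral_cmult) measurable
    also have "\<dots> < \<infinity>" using fin1(1) by (simp add: ennreal_mult_less_top)
    finally show ?thesis .
  qed
  have NR: "(\<integral>\<^sup>+z. ennreal (norm z powr (- s)) * R z \<partial>lborel) < \<infinity>"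
  proof -
    have "stretch 1 1 z = z" for z by (simp add: vec_eq_iff forall_3)
    then show ?thesis using N_le[of 1 1] by (simp add: N_def)
  qed
  obtain \<kappa> where \<kappa>: "0 < \<kappa>" "\<And>x y. 0 < x \<Longrightarrow> 0 < y \<Longrightarrow> V x y = ennreal \<kappa> * gauss_moment g (x\<^sup>2) (y\<^sup>2)"
  proof (rule homogeneous_radial_ratio[OF gaussian(1) R_meas f0 hom s(1) R_rad R0 NR])
    fix x y :: real assume xy: "0 < x" "0 < y"
    show "(\<integral>\<^sup>+z. ennreal (f (stretch x y z) * spheroidal_gauss 1 1 z) \<partial>lborel) < \<infinity>"
      "(\<integral>\<^sup>+z. ennreal (f (stretch x y z) * spheroidal_gauss 1 1 z) \<partial>lborel) \<noteq> 0"
      unfolding gaussian(3)[OF xy] gauss_moment_def[symmetric] using moment_fin[OF xy] moment_pos by auto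
  next
    fix \<kappa> assume "0 < \<kappa>" and \<kappa>: "\<And>a b. 0 < a \<Longrightarrow> 0 < b \<Longrightarrow> (\<integral>\<^sup>+z. ennreal (f (stretch a b z)) * R z \<partial>lborel) =
      ennreal \<kappa> * (\<integral>\<^sup>+x. ennreal (f (stretch a b x) * spheroidal_gauss 1 1 x) \<partial>lborel)"
    show thesis
    proof (rule that[OF \<open>0 < \<kappa>\<close>])
      fix x y :: real assume xy: "0 < x" "0 < y"
      show "V x y = ennreal \<kappa> * gauss_moment g (x\<^sup>2) (y\<^sup>2)"
        unfolding V_def \<kappa>[OF xy] gaussian(3)[OF xy] gauss_moment_def ..
    qed
  qed
  let ?J = "tilted_moment \<kappa> m1 m2 g"
  \<comment> \<open>Lengths in units of \<open>l = \<alpha>\<^sup>1\<^sup>/\<^sup>(\<^sup>2\<^sup>+\<^sup>s\<^sup>)\<close>: then \<open>\<alpha> l\<^sup>-\<^sup>s = l\<^sup>2\<close>, and the isotropic part retains a factor \<open>1/\<alpha>\<close>.\<close>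
  have E_scale: "E \<alpha> (l * x) (l * y) = ennreal (l\<^sup>2) * (ennreal (1 / \<alpha>) * N x y + ?J (x\<^sup>2) (y\<^sup>2))"
    if "0 < \<alpha>" "0 < x" "0 < y" "l = \<alpha> powr (1 / (2 + s))" for \<alpha> l x y
  proof -
    have l: "0 < l" using that by simp
    have "l\<^sup>2 = l powr (- s) * l powr (2 + s)" using l by (simp flip: powr_add powr_numeral)
    also have "l powr (2 + s) = \<alpha>" unfolding that(4) using that s by (simp add: powr_powr)
    finally have ls: "l powr (- s) = l\<^sup>2 * (1 / \<alpha>)" using that by (simp add: field_simps)
    have hom_int: "(\<integral>\<^sup>+z. ennreal (l powr (- s) * h z) * R z \<partial>lborel) =
        ennreal (l\<^sup>2) * (ennreal (1 / \<alpha>) * (\<integral>\<^sup>+z. ennreal (h z) * R z \<partial>lborel))"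
      if [measurable]: "h \<in> borel_measurable borel" for h
    proof -
      have "(\<integral>\<^sup>+z. ennreal (l powr (- s) * h z) * R z \<partial>lborel) =
          (\<integral>\<^sup>+z. ennreal (l\<^sup>2) * (ennreal (1 / \<alpha>) * (ennreal (h z) * R z)) \<partial>lborel)"
        unfolding ls using \<open>0 < \<alpha>\<close> by (simp only: ennreal_mult' mult.assoc zero_le_power2
          zero_le_divide_1_iff less_imp_le)
      then show ?thesis by (simp add: nn_integral_cmult)
    qed
    have "norm (stretch (l * x) (l * y) z) powr (- s) = l powr (- s) * norm (stretch x y z) powr (- s)" for z
      using l by (simp add: stretch_mult powr_mult)
    then have N: "N (l * x) (l * y) = ennreal (l\<^sup>2) * (ennreal (1 / \<alpha>) * N x y)"
      unfolding N_def by (simp only:) (rule hom_int, measurable)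
    have "f (stretch (l * x) (l * y) z) = l powr (- s) * f (stretch x y z)" for z
      using l by (simp add: stretch_mult hom)
    then have V: "V (l * x) (l * y) = ennreal (l\<^sup>2) * (ennreal (1 / \<alpha>) * V x y)"
      unfolding V_def by (simp only:) (rule hom_int, measurable)
    have "ennreal \<alpha> * V (l * x) (l * y) = ennreal (l\<^sup>2) * ((ennreal \<alpha> * ennreal (1 / \<alpha>)) * V x y)"
      unfolding V by (simp only: mult_ac)
    also have "ennreal \<alpha> * ennreal (1 / \<alpha>) = 1" using that by (simp flip: ennreal_mult')
    finally have V': "ennreal \<alpha> * V (l * x) (l * y) = ennreal (l\<^sup>2) * V x y" by simp
    have M: "ennreal ((l * x)\<^sup>2) * M1 + ennreal ((l * y)\<^sup>2) * M2 = ennreal (l\<^sup>2) * ennreal (m1 * x\<^sup>2 + m2 * y\<^sup>2)"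
      unfolding m using m(2,4) by (simp add: power_mult_distrib algebra_simps flip: ennreal_mult' ennreal_plus)
    show ?thesis
      unfolding E_def N V' M tilted_moment_def \<kappa>(2)[OF that(2,3), symmetric]
      by (simp only: distrib_left add.assoc)
  qed
  obtain p q where pq: "0 < p" "0 < q"
    and conv: "\<forall>P Q U. (\<forall>n. 0 \<le> P n \<and> 0 \<le> Q n \<and> ?J (P n) (Q n) \<le> U n) \<longrightarrow>
       U \<longlonglongrightarrow> ?J p q \<longrightarrow> P \<longlonglongrightarrow> p \<and> Q \<longlonglongrightarrow> q"
  proof (rule tilted_moment_well_posed[OF gaussian(2) s c(1) lower \<kappa>(1) m(2,4)])
    show "gauss_moment g 1 1 < \<infinity>" using moment_fin[of 1 1] by simp
  qed (rule that)
  define A where "A \<alpha> = a \<alpha> * \<alpha> powr (- 1 / (2 + s))" for \<alpha>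
  define B where "B \<alpha> = b \<alpha> * \<alpha> powr (- 1 / (2 + s))" for \<alpha>
  have AB: "0 < A \<alpha>" "0 < B \<alpha>" if "0 < \<alpha>" for \<alpha> using ab[OF that] that by (simp_all add: A_def B_def)
  \<comment> \<open>Comparison with the minimizer \<open>(\<surd>p, \<surd>q)\<close> of the limit problem; dropping the isotropic term on the left keeps the inequality.\<close>
  have J_le: "?J ((A \<alpha>)\<^sup>2) ((B \<alpha>)\<^sup>2) \<le> ennreal (1 / \<alpha>) * N (sqrt p) (sqrt q) + ?J p q" if \<alpha>: "0 < \<alpha>" for \<alpha>
  proof -
    define l where "l = \<alpha> powr (1 / (2 + s))"
    have l: "0 < l" using \<alpha> by (simp add: l_def)
    have "l * \<alpha> powr (- 1 / (2 + s)) = 1" using \<alpha> by (simp add: l_def flip: powr_add)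
    then have eq: "l * A \<alpha> = a \<alpha>" "l * B \<alpha> = b \<alpha>" by (simp_all add: A_def B_def mult.left_commute)
    have "E \<alpha> (l * A \<alpha>) (l * B \<alpha>) \<le> E \<alpha> (l * sqrt p) (l * sqrt q)"
      unfolding eq using l pq by (intro minE \<alpha>) auto
    then have "ennreal (l\<^sup>2) * (ennreal (1 / \<alpha>) * N (A \<alpha>) (B \<alpha>) + ?J ((A \<alpha>)\<^sup>2) ((B \<alpha>)\<^sup>2)) \<le>
        ennreal (l\<^sup>2) * (ennreal (1 / \<alpha>) * N (sqrt p) (sqrt q) + ?J p q)"
      using E_scale[OF \<alpha> AB[OF \<alpha>] l_def] E_scale[OF \<alpha> _ _ l_def, of "sqrt p" "sqrt q"] pq by simp
    then have "ennreal (1 / \<alpha>) * N (A \<alpha>) (B \<alpha>) + ?J ((A \<alpha>)\<^sup>2) ((B \<alpha>)\<^sup>2) \<le>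
        ennreal (1 / \<alpha>) * N (sqrt p) (sqrt q) + ?J p q"
      using l by (subst (asm) ennreal_mult_le_mult_iff) auto
    then show ?thesis by (rule order_trans[rotated]) simp
  qed
  have lim: "(\<lambda>n. A (X n)) \<longlonglongrightarrow> sqrt p \<and> (\<lambda>n. B (X n)) \<longlonglongrightarrow> sqrt q"
    if X: "filterlim X at_top sequentially" for X :: "nat \<Rightarrow> real"
  proof -
    \<comment> \<open>The bounds hold for positive \<open>\<alpha>\<close>; replacing finitely many terms does not affect the limits.\<close>
    define Y where "Y n = max (X n) 1" for n
    have Y: "0 < Y n" for n by (simp add: Y_def)
    have ev: "eventually (\<lambda>n. Y n = X n) sequentially"
      using X[unfolded filterlim_at_top, rule_format, of 1] by eventually_elim (simp add: Y_def)
    have "(\<lambda>n. 1 / X n) \<longlonglongrightarrow> 0" using X by (intro tendsto_divide_0[OF tendsto_const] filterlim_at_top_imp_at_infinity)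
    then have Y0: "(\<lambda>n. 1 / Y n) \<longlonglongrightarrow> 0" by (rule Lim_transform_eventually) (use ev in eventually_elim, simp)
    have "(\<lambda>n. N (sqrt p) (sqrt q) * ennreal (1 / Y n) + ?J p q) \<longlonglongrightarrow> N (sqrt p) (sqrt q) * ennreal 0 + ?J p q"
      using N_le[of "sqrt p" "sqrt q"] pq
      by (intro tendsto_add ennreal_tendsto_cmult tendsto_const tendsto_ennrealI Y0) auto
    then have "(\<lambda>n. ennreal (1 / Y n) * N (sqrt p) (sqrt q) + ?J p q) \<longlonglongrightarrow> ?J p q" by (simp add: mult.commute)
    then have PQ: "(\<lambda>n. (A (Y n))\<^sup>2) \<longlonglongrightarrow> p \<and> (\<lambda>n. (B (Y n))\<^sup>2) \<longlonglongrightarrow> q"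
      by (intro conv[rule_format, where U = "\<lambda>n. ennreal (1 / Y n) * N (sqrt p) (sqrt q) + ?J p q"])
        (auto intro: J_le Y)
    then have "(\<lambda>n. sqrt ((A (Y n))\<^sup>2)) \<longlonglongrightarrow> sqrt p" "(\<lambda>n. sqrt ((B (Y n))\<^sup>2)) \<longlonglongrightarrow> sqrt q"
      by (simp_all only: tendsto_real_sqrt)
    then have AY: "(\<lambda>n. A (Y n)) \<longlonglongrightarrow> sqrt p" and BY: "(\<lambda>n. B (Y n)) \<longlonglongrightarrow> sqrt q"
      using AB[OF Y] by (simp_all add: less_imp_le)
    have "eventually (\<lambda>n. A (Y n) = A (X n)) sequentially" "eventually (\<lambda>n. B (Y n) = B (X n)) sequentially"
      using ev by (eventually_elim, simp)+
    from Lim_transform_eventually[OF AY this(1)] Lim_transform_eventually[OF BY this(2)]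
    show ?thesis ..
  qed
  have "(A \<longlongrightarrow> sqrt p) at_top" "(B \<longlongrightarrow> sqrt q) at_top"
    using lim by (auto intro!: tendsto_at_topI_sequentially)
  moreover have "0 < sqrt p" "0 < sqrt q" using pq by simp_all
  ultimately show ?thesis unfolding A_def[abs_def] B_def[abs_def] by blast
qed

end
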